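(* Let $p$ be any prime and $d=p^2$. Let $\mathcal{P}'$ be the set of $p^4$ rank one projections on $\mathbb{C}^{d}$ defined in the context. Then the quantum mechanical overlaps $\mathrm{tr}(PP')$, $P,P'\in\mathcal{P}'$, have values in $\{0,\ 1/p,\ 1/p^2,\ 1\}$.
   Context: Let $d=p^2$, $\mathbb{Z}_d=\{0,\dots,d-1\}$ the ring of integers modulo $d$, $\{|k\rangle:k\in\mathbb{Z}_d\}$ the standard orthonormal basis of $\mathbb{C}^d$, $\eta_d=e^{2\pi i/d}$, and $U_{m,n}|k\rangle=\eta_d^{mk}|n+k\rangle$ for $m,n\in\mathbb{Z}_d$. For $0\le r,a\le p-1$, the unitary $U_{ap+r,1}$ has the $p^2$ simple eigenvalues $$\gamma(r,a;c,s)=e^{\frac{\pi i}{p^2}(ap+r)(p-1)}e^{\frac{2\pi i c}{p^2}}e^{\frac{2\pi i s}{p}},\quad 0\le c,s\le p-1;$$ let $P(r,a;c,s)$ be the rank one projection onto the eigenspace for $\gamma(r,a;c,s)$. For $1\le b\le p-1$ and $0\le t\le p-1$, the unitary $U_{1,bp}$ leaves invariant the span $E_t$ of $\{|vp+t\rangle:0\le v\le p-1\}$ and has $p$ simple eigenvalues there; if $p$ is odd they are $\gamma_{t,s}=e^{2\pi i t/p^2}e^{2\pi i s/p}$, $0\le s\le p-1$; if $p=2$ (so $b=1$) label the two eigenvalues on $E_t$ by $s=0,1$ in either order. Let $P_{b,t,s}$ be the rank one projection onto the eigenline of $U_{1,bp}$ in $E_t$ for the eigenvalue labelled $s$. Put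 $\mathcal{P}_0^{(p)}=\{|j\rangle\langle j|:0\le j\le p^2-1\}$; for $1\le b\le p-1$, $\mathcal{P}_b^{(p)\prime}=\{P_{b,t,s}:0\le t\le p-1,\ 1\le s\le p-1\}$; for $0\le r\le p-1$, $\mathcal{P}_0^{(r)\prime}=\{P(r,0;c,s):0\le c,s\le p-1,\ (c,s)\ne(0,0)\}$, and for $1\le a\le p-1$, $\mathcal{P}_a^{(r)\prime}=\{P(r,a;c,s):0\le c\le p-1,\ 1\le s\le p-1\}$. Finally $$\mathcal{P}'=\mathcal{P}_0^{(p)}\cup\bigcup_{b=1}^{p-1}\mathcal{P}_b^{(p)\prime}\cup\bigcup_{0\le r,a\le p-1}\mathcal{P}_a^{(r)\prime}.$$ *)

theory Defs
  imports
    "Jordan_Normal_Form.Schur_Decomposition"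
    "Jordan_Normal_Form.DL_Rank"
    "HOL-Computational_Algebra.Primes"
begin

definition mat_trace :: "complex mat \<Rightarrow> complex" where
  "mat_trace A = (\<Sum>i<dim_row A. A $$ (i, i))"

definition ketbra :: "complex vec \<Rightarrow> complex vec \<Rightarrow> complex mat" where
  "ketbra u v = mat (dim_vec u) (dim_vec v) (\<lambda>(i, k). u $ i * cnj (v $ k))"

definition orth_projection :: "nat \<Rightarrow> complex mat \<Rightarrow> bool" where
  "orth_projection d P \<longleftrightarrow> P \<in> carrier_mat d d \<and> P * P = P \<and> mat_adjoint P = P"

definition rank_one_projection :: "nat \<Rightarrow> complex mat \<Rightarrow> bool" where
  "rank_one_projection d P \<longleftrightarrow> orth_projection d P \<and> vec_space.rank d P = 1"

definition proj_onto :: "nat \<Rightarrow> complex vec set \<Rightarrow> complex mat" where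
  "proj_onto d S =
     (THE P. orth_projection d P \<and> (\<lambda>v. P *\<^sub>v v) ` carrier_vec d = S)"

definition root_of_unity :: "nat \<Rightarrow> complex" where
  "root_of_unity d = exp (2 * of_real pi * \<i> / of_nat d)"

text \<open>The matrix of the unitary sending the basis vector \<open>k\<close> to
  \<open>\<eta>\<^sub>d ^ (m k)\<close> times the basis vector \<open>n + k\<close> modulo \<open>d\<close>; its \<open>k\<close>-th column is the image
  of the \<open>k\<close>-th basis vector.\<close>

definition weyl :: "nat \<Rightarrow> nat \<Rightarrow> nat \<Rightarrow> complex mat" where
  "weyl d m n =
     mat d d (\<lambda>(j, k). if j = (n + k) mod d then root_of_unity d ^ (m * k) else 0)"

definition eigenspace :: "nat \<Rightarrow> complex mat \<Rightarrow> complex \<Rightarrow> complex vec set" where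
  "eigenspace d U l = {v \<in> carrier_vec d. U *\<^sub>v v = l \<cdot>\<^sub>v v}"

definition gam :: "nat \<Rightarrow> nat \<Rightarrow> nat \<Rightarrow> nat \<Rightarrow> nat \<Rightarrow> complex" where
  "gam p r a c s =
     exp (of_real pi * \<i> / of_nat (p^2) * of_nat (a * p + r) * (of_nat p - 1)) *
     exp (2 * of_real pi * \<i> * of_nat c / of_nat (p^2)) *
     exp (2 * of_real pi * \<i> * of_nat s / of_nat p)"

definition proj_P :: "nat \<Rightarrow> nat \<Rightarrow> nat \<Rightarrow> nat \<Rightarrow> nat \<Rightarrow> complex mat" where
  "proj_P p r a c s = proj_onto (p^2) (eigenspace (p^2) (weyl (p^2) (a * p + r) 1) (gam p r a c s))"

definition E_space :: "nat \<Rightarrow> nat \<Rightarrow> complex vec set" where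
  "E_space p t =
     LinearCombinations.module.span class_ring (module_vec TYPE(complex) (p^2)) ((\<lambda>v. unit_vec (p^2) (v * p + t)) ` {..<p})"

text \<open>\<open>g t s\<close> is the eigenvalue on \<open>E_space p t\<close> carrying the label \<open>s\<close>. For odd \<open>p\<close> the labelling
  is prescribed, and is the same for all the unitaries \<open>weyl (p^2) 1 (b * p)\<close>. For \<open>p = 2\<close>, where
  only \<open>b = 1\<close> occurs, the two eigenvalues may be enumerated in either order, independently
  for each \<open>t\<close>.\<close>

definition eigenvalue_labelling :: "nat \<Rightarrow> (nat \<Rightarrow> nat \<Rightarrow> complex) \<Rightarrow> bool" where
  "eigenvalue_labelling p g \<longleftrightarrow>
     (if odd p
      then \<forall>t<p. \<forall>s<p. g t s = exp (2 * of_real pi * \<i> * of_nat t / of_nat (p^2)) *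
                              exp (2 * of_real pi * \<i> * of_nat s / of_nat p)
      else \<forall>t<p. bij_betw (g t) {..<p}
                   {l. \<exists>v\<in>E_space p t. eigenvector (weyl (p^2) 1 p) v l})"

definition proj_Q :: "nat \<Rightarrow> (nat \<Rightarrow> nat \<Rightarrow> complex) \<Rightarrow> nat \<Rightarrow> nat \<Rightarrow> nat \<Rightarrow> complex mat" where
  "proj_Q p g b t s =
     proj_onto (p^2) (eigenspace (p^2) (weyl (p^2) 1 (b * p)) (g t s) \<inter> E_space p t)"

definition standard_projs :: "nat \<Rightarrow> complex mat set" where
  "standard_projs p = {ketbra (unit_vec (p^2) j) (unit_vec (p^2) j) | j. j < p^2}"

definition Q_projs :: "nat \<Rightarrow> (nat \<Rightarrow> nat \<Rightarrow> complex) \<Rightarrow> nat \<Rightarrow> complex mat set" where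
  "Q_projs p g b = {proj_Q p g b t s | t s. t < p \<and> 1 \<le> s \<and> s < p}"

definition P_projs :: "nat \<Rightarrow> nat \<Rightarrow> nat \<Rightarrow> complex mat set" where
  "P_projs p r a =
     (if a = 0 then {proj_P p r 0 c s | c s. c < p \<and> s < p \<and> (c, s) \<noteq> (0, 0)}
      else {proj_P p r a c s | c s. c < p \<and> 1 \<le> s \<and> s < p})"

definition P_prime :: "nat \<Rightarrow> (nat \<Rightarrow> nat \<Rightarrow> complex) \<Rightarrow> complex mat set" where
  "P_prime p g =
     standard_projs p \<union> (\<Union>b\<in>{1..<p}. Q_projs p g b) \<union> (\<Union>r\<in>{..<p}. \<Union>a\<in>{..<p}. P_projs p r a)"

end

theory Submission
  imports Defs "HOL-Number_Theory.Cong"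
begin

text \<open>Every projection is given by an explicit unit vector. The eigenvector of \<open>weyl (p\<^sup>2) m 1\<close>
  labelled by \<open>c\<close> has \<open>k\<close>-th entry \<open>exp (\<pi> i (m k (k - p) - 2 k c) / p\<^sup>2) / p\<close>, and the
  eigenvectors on \<open>E_space p t\<close> have entries \<open>exp (\<pi> i (\<alpha> v\<^sup>2 + \<beta> v) / p) / sqrt p\<close> at \<open>v p + t\<close>, where
  \<open>\<alpha>\<close> is inverse to \<open>b\<close> modulo \<open>p\<close>. Writing \<open>k = v p + t\<close>, the first phase becomes linear in \<open>v\<close> for
  fixed \<open>t\<close>; so every inner product reduces to sums over one block, which are either geometric or
  quadratic Gauss sums of modulus \<open>sqrt p\<close>. Phases \<open>exp (\<pi> i x / n)\<close>, with half the usual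
  argument, cover \<open>p = 2\<close> along with the odd primes. Two projections with different labels
  never have overlap 1, hence they differ and the \<open>p ^ 4\<close> labels can simply be counted.\<close>

section \<open>Phases and quadratic Gauss sums\<close>

text \<open>The period in \<open>x\<close> is \<open>2 * n\<close>, so only even multiples of
  \<open>n\<close> may be dropped from an exponent. The parity conditions that recur below come from
  this.\<close>

definition phase :: "nat \<Rightarrow> int \<Rightarrow> complex" where
  "phase n x = cis (pi * of_int x / of_nat n)"

lemma phase_0 [simp]: "phase n 0 = 1"
  by (simp add: phase_def)

lemma norm_phase [simp]: "cmod (phase n x) = 1"
  by (simp add: phase_def)

lemma phase_nonzero [simp]: "phase n x \<noteq> 0"
  by (simp add: phase_def)

lemma phase_add: "phase n (x + y) = phase n x * phase n y"
  by (simp add: phase_def cis_mult ring_distribs add_divide_distrib)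

lemma cnj_phase: "cnj (phase n x) = phase n (- x)"
  by (simp add: phase_def cis_cnj)

lemma phase_mult_cnj: "phase n x * cnj (phase n y) = phase n (x - y)"
  by (simp add: cnj_phase flip: phase_add)

lemma phase_power: "phase n x ^ k = phase n (int k * x)"
  by (simp add: phase_def DeMoivre mult_ac)

text \<open>Taken with \<open>m\<close> and \<open>n\<close> both equal to \<open>p\<close>, this
  passes from phases of level p^2 to phases of level p.\<close>

lemma phase_reduce:
  assumes "m > 0"
  shows "phase (m * n) (int m * x) = phase n x"
  using assms by (simp add: phase_def)

lemma phase_even_eq_1_iff:
  assumes "n > 0"
  shows "phase n (2 * x) = 1 \<longleftrightarrow> int n dvd x"
proof
  assume "phase n (2 * x) = 1"
  \<comment> \<open>The real part suffices: the cosine is 1 only at integer multiples of 2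
    pi.\<close>
  then have "cos (pi * of_int (2 * x) / of_nat n) = 1"
    unfolding phase_def by (metis cis.sel(1) one_complex.sel(1))
  then obtain k :: int where "pi * of_int (2 * x) / of_nat n = of_int k * 2 * pi"
    by (auto simp: cos_one_2pi_int)
  then have "of_int x = (of_int (k * int n) :: real)"
    using assms by (simp add: field_simps)
  then have "x = k * int n"
    by (simp only: of_int_eq_iff)
  then show "int n dvd x" by simp
next
  assume "int n dvd x"
  then obtain k where k: "x = int n * k" by (elim dvdE)
  have "phase n (2 * x) = cis (2 * pi * of_int k)"
    using assms unfolding phase_def k by (simp add: field_simps)
  then show "phase n (2 * x) = 1" by simp
qed

lemma phase_eq_1:
  assumes "n > 0" "even y"
  shows "phase n (int n * y) = 1"
proof -
  obtain z where "y = 2 * z" using assms(2) by (elim evenE)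
  then have "int n * y = 2 * (int n * z)" by simp
  then show ?thesis using phase_even_eq_1_iff[OF assms(1)] by (metis dvd_triv_left)
qed

text \<open>In each use the even multiplier \<open>y\<close> is given explicitly, which leaves a
  polynomial identity to check.\<close>

lemma phase_cong:
  assumes "n > 0" "even y" "a = b + int n * y"
  shows "phase n a = phase n b"
  using phase_eq_1[OF assms(1,2)] by (simp add: assms(3) phase_add)

text \<open>Orthogonality of characters: a geometric sum whose ratio is an n-th root of
  unity.\<close>

lemma sum_phase:
  assumes "n > 0"
  shows "(\<Sum>v<n. phase n (2 * (x * int v))) = (if int n dvd x then of_nat n else 0)"
proof -
  define z where "z = phase n (2 * x)"
  have z: "phase n (2 * (x * int v)) = z ^ v" for v
    by (simp add: z_def phase_power mult_ac)
  show ?thesis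
  proof (cases "int n dvd x")
    case True
    then have "z = 1" unfolding z_def using phase_even_eq_1_iff[OF assms] by blast
    then show ?thesis using True by (simp add: z)
  next
    case False
    then have "z \<noteq> 1" unfolding z_def using phase_even_eq_1_iff[OF assms] by blast
    moreover have "z ^ n = 1"
      unfolding z_def phase_power by (rule phase_eq_1) (use assms in auto)
    ultimately show ?thesis using False by (simp add: z geometric_sum)
  qed
qed

text \<open>A shift by one trades the term at \<open>h\<close> for the term at \<open>n + h\<close>,
  and periodicity makes them equal.\<close>

lemma sum_periodic_shift:
  fixes f :: "int \<Rightarrow> complex"
  assumes "\<And>x. f (x + int n) = f x"
  shows "(\<Sum>v<n. f (int v + int h)) = (\<Sum>v<n. f (int v))"
proof (induction h)
  case (Suc h)
  have "(\<Sum>v<n. f (int v + int (Suc h))) + f (int h) = (\<Sum>v<Suc n. f (int v + int h))"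
    by (subst sum.lessThan_Suc_shift) (simp add: ac_simps)
  also have "\<dots> = (\<Sum>v<n. f (int v + int h)) + f (int h)"
    using assms[of "int h"] by (simp add: add.commute)
  finally show ?case using Suc by simp
qed simp

definition quad_phase :: "nat \<Rightarrow> int \<Rightarrow> int \<Rightarrow> int \<Rightarrow> complex" where
  "quad_phase n \<alpha> \<beta> v = phase n (\<alpha> * v\<^sup>2 + \<beta> * v)"

lemma norm_quad_phase [simp]: "cmod (quad_phase n \<alpha> \<beta> v) = 1"
  by (simp add: quad_phase_def)

text \<open>Raising \<open>v\<close> by \<open>n\<close> adds \<open>n\<close> times
  \<open>2 * \<alpha> * v + (\<alpha> * n + \<beta>)\<close> to the exponent. The parity assumption
  makes this multiplier even, so that sums over \<open>v < n\<close> are sums over residue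
  classes.\<close>

lemma quad_phase_periodic:
  assumes "n > 0" "even (\<alpha> * int n + \<beta>)"
  shows "quad_phase n \<alpha> \<beta> (v + int n) = quad_phase n \<alpha> \<beta> v"
  unfolding quad_phase_def
proof (rule phase_cong[OF assms(1)])
  show "even (2 * \<alpha> * v + (\<alpha> * int n + \<beta>))" using assms(2) by simp
qed (simp add: power2_eq_square algebra_simps)

text \<open>The square of the modulus is the sum over \<open>v\<close> and \<open>h\<close> of
  \<open>f (v + h) * cnj (f v) = f h * phase n (2 \<alpha> v h)\<close>, in which only \<open>h = 0\<close> survives.\<close>

lemma norm_gauss_sum:
  assumes n: "n > 0" and "coprime \<alpha> (int n)" and ev: "even (\<alpha> * int n + \<beta>)"
  shows "(cmod (\<Sum>v<n. quad_phase n \<alpha> \<beta> (int v)))\<^sup>2 = of_nat n"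
proof -
  let ?f = "quad_phase n \<alpha> \<beta>"
  have dvd: "int n dvd \<alpha> * int h \<longleftrightarrow> h = 0" if "h < n" for h
    using assms that coprime_dvd_mult_right_iff[of "int n" \<alpha> "int h"]
    by (auto simp: coprime_commute dest: nat_dvd_not_less)
  have "of_real ((cmod (\<Sum>v<n. ?f (int v)))\<^sup>2)
      = (\<Sum>v<n. (\<Sum>h<n. ?f (int h)) * cnj (?f (int v)))"
    by (simp only: complex_norm_square cnj_sum sum_distrib_left)
  \<comment> \<open>A full period may start anywhere; here the sum over \<open>h\<close> starts at
    \<open>v\<close>.\<close>
  also have "\<dots> = (\<Sum>v<n. (\<Sum>h<n. ?f (int h + int v)) * cnj (?f (int v)))"
    by (simp only: sum_periodic_shift[of ?f n, OF quad_phase_periodic[OF n ev]])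
  also have "\<dots> = (\<Sum>v<n. \<Sum>h<n. ?f (int h) * phase n (2 * (\<alpha> * int h * int v)))"
    unfolding sum_distrib_right quad_phase_def phase_mult_cnj phase_add[symmetric]
    by (intro sum.cong refl arg_cong[of _ _ "phase n"]) (simp add: power2_eq_square algebra_simps)
  also have "\<dots> = (\<Sum>h<n. ?f (int h) * (\<Sum>v<n. phase n (2 * (\<alpha> * int h * int v))))"
    by (subst sum.swap) (simp only: sum_distrib_left)
  also have "\<dots> = (\<Sum>h<n. if h = 0 then of_nat n else 0)"
    by (intro sum.cong refl) (simp add: sum_phase[OF n] dvd quad_phase_def)
  also have "\<dots> = of_nat n" using n by simp
  finally show ?thesis by (metis of_real_eq_iff of_real_of_nat_eq)
qed

section \<open>Rank one projections\<close>

lemma ketbra_mult_vec: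
  assumes "w \<in> carrier_vec (dim_vec v)"
  shows "ketbra u v *\<^sub>v w = (w \<bullet>c v) \<cdot>\<^sub>v u"
  using assms
  by (intro eq_vecI)
    (auto simp: ketbra_def scalar_prod_def sum_distrib_left mult_ac intro!: sum.cong)

lemma mat_adjoint_index [simp]:
  "dim_row (mat_adjoint A) = dim_col A" "dim_col (mat_adjoint A) = dim_row A"
  "i < dim_col A \<Longrightarrow> j < dim_row A \<Longrightarrow> mat_adjoint A $$ (i, j) = conjugate (A $$ (j, i))"
  by (auto simp: mat_adjoint_def mat_of_rows_def)

lemma mat_adjoint_mult:
  fixes A B :: "complex mat"
  assumes "A \<in> carrier_mat n m" "B \<in> carrier_mat m l"
  shows "mat_adjoint (A * B) = mat_adjoint B * mat_adjoint A"
  using assms by (intro eq_matI) (auto simp: scalar_prod_def mult.commute)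

lemma mat_eqI_mult_vec:
  fixes A B :: "complex mat"
  assumes "A \<in> carrier_mat n m" "B \<in> carrier_mat n m"
    and "\<And>v. v \<in> carrier_vec m \<Longrightarrow> A *\<^sub>v v = B *\<^sub>v v"
  shows "A = B"
proof (rule eq_matI)
  fix i j assume ij: "i < dim_row B" "j < dim_col B"
  have "(A *\<^sub>v unit_vec m j) $ i = (B *\<^sub>v unit_vec m j) $ i"
    using assms(3) by simp
  then show "A $$ (i, j) = B $$ (i, j)"
    using assms(1,2) ij by auto
qed (use assms in auto)

text \<open>An idempotent fixes its range pointwise, so equal ranges give \<open>P * Q = Q\<close>
  and \<open>Q * P = P\<close>. The adjoint of the second equation is \<open>P = P * Q\<close>. This
  is the uniqueness behind the description operator in \<open>proj_onto\<close>.\<close>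

lemma orth_projection_unique:
  assumes P: "orth_projection d P" and Q: "orth_projection d Q"
    and eq: "(\<lambda>v. P *\<^sub>v v) ` carrier_vec d = (\<lambda>v. Q *\<^sub>v v) ` carrier_vec d"
  shows "P = Q"
proof -
  have absorb: "A * B = B"
    if A: "orth_projection d A" and B: "orth_projection d B"
      and img: "(\<lambda>v. A *\<^sub>v v) ` carrier_vec d = (\<lambda>v. B *\<^sub>v v) ` carrier_vec d" for A B
  proof (rule mat_eqI_mult_vec[of _ d d])
    have [simp]: "A \<in> carrier_mat d d" "B \<in> carrier_mat d d"
      using A B by (auto simp: orth_projection_def)
    show "A * B \<in> carrier_mat d d" by (rule mult_carrier_mat[of _ d d]) auto
    show "B \<in> carrier_mat d d" by simp
    fix v :: "complex vec" assume v: "v \<in> carrier_vec d"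
    then obtain w where w: "w \<in> carrier_vec d" "B *\<^sub>v v = A *\<^sub>v w"
      using img by blast
    have "A * B *\<^sub>v v = A *\<^sub>v (A *\<^sub>v w)"
      using v w by (subst assoc_mult_mat_vec[of _ d d _ d]) auto
    also have "\<dots> = A * A *\<^sub>v w"
      using w by (subst assoc_mult_mat_vec[of _ d d _ d]) auto
    also have "\<dots> = B *\<^sub>v v" using A w by (simp add: orth_projection_def)
    finally show "A * B *\<^sub>v v = B *\<^sub>v v" .
  qed
  have "P = mat_adjoint (Q * P)"
    using absorb[OF Q P eq[symmetric]] P by (simp add: orth_projection_def)
  also have "\<dots> = P * Q"
    using P Q by (subst mat_adjoint_mult[of _ d d _ d]) (auto simp: orth_projection_def)
  also have "\<dots> = Q" by (rule absorb[OF P Q eq])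
  finally show ?thesis .
qed

lemma orth_projection_ketbra:
  assumes u: "u \<in> carrier_vec d" and norm: "u \<bullet>c u = 1"
  shows "orth_projection d (ketbra u u)"
proof -
  have "ketbra u u * ketbra u u = ketbra u u"
  proof (rule mat_eqI_mult_vec[of _ d d])
    fix v :: "complex vec" assume v: "v \<in> carrier_vec d"
    have "ketbra u u * ketbra u u *\<^sub>v v = ketbra u u *\<^sub>v (ketbra u u *\<^sub>v v)"
      using u v by (subst assoc_mult_mat_vec[of _ d d _ d]) (auto simp: ketbra_def)
    then show "ketbra u u * ketbra u u *\<^sub>v v = ketbra u u *\<^sub>v v"
      using u v norm by (simp add: ketbra_mult_vec)
  qed (use u in \<open>auto simp: ketbra_def\<close>)
  moreover have "mat_adjoint (ketbra u u) = ketbra u u"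
    by (intro eq_matI) (auto simp: ketbra_def mult.commute)
  ultimately show ?thesis using u by (auto simp: orth_projection_def ketbra_def)
qed

lemma range_ketbra:
  assumes u: "u \<in> carrier_vec d" and norm: "u \<bullet>c u = 1"
  shows "(\<lambda>v. ketbra u u *\<^sub>v v) ` carrier_vec d = {c \<cdot>\<^sub>v u | c. True}"
proof (intro equalityI subsetI)
  fix w assume "w \<in> {c \<cdot>\<^sub>v u | c. True}"
  then obtain c where w: "w = c \<cdot>\<^sub>v u" by blast
  then have "ketbra u u *\<^sub>v w = w" "w \<in> carrier_vec d" using u norm by (auto simp: ketbra_mult_vec)
  then show "w \<in> (\<lambda>v. ketbra u u *\<^sub>v v) ` carrier_vec d" by (metis image_eqI)
qed (use u in \<open>auto simp: ketbra_mult_vec\<close>)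

text \<open>Evaluates \<open>proj_onto\<close> as soon as an eigenspace is known to be the line
  through a unit vector.\<close>

lemma proj_onto_line:
  assumes "u \<in> carrier_vec d" "u \<bullet>c u = 1"
  shows "proj_onto d {c \<cdot>\<^sub>v u | c. True} = ketbra u u"
  unfolding proj_onto_def
proof (rule the_equality)
  fix P assume "orth_projection d P \<and> (\<lambda>v. P *\<^sub>v v) ` carrier_vec d = {c \<cdot>\<^sub>v u | c. True}"
  then show "P = ketbra u u"
    by (intro orth_projection_unique[of d])
      (simp_all add: orth_projection_ketbra[OF assms] range_ketbra[OF assms])
qed (simp add: orth_projection_ketbra[OF assms] range_ketbra[OF assms])

text \<open>The rank is at most 1 because the entries are products of a row factor and a column
  factor. It is not 0 because a column \<open>j\<close> with \<open>u $ j\<close> nonzero is a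
  nonzero multiple of \<open>u\<close>, hence linearly independent by itself.\<close>

lemma rank_ketbra:
  assumes u: "u \<in> carrier_vec d" and norm: "u \<bullet>c u = 1"
  shows "vec_space.rank d (ketbra u u) = 1"
proof -
  interpret vec_space "TYPE(complex)" d .
  have "rank (ketbra u u) \<le> 1"
    using u by (intro rank_le_1_product_entries[of _ d "\<lambda>i. u $ i" "\<lambda>k. cnj (u $ k)"])
      (auto simp: ketbra_def)
  moreover have "rank (ketbra u u) \<noteq> 0"
  proof
    assume "rank (ketbra u u) = 0"
    have "u \<noteq> 0\<^sub>v d" using norm by auto
    then obtain j where j: "j < d" "u $ j \<noteq> 0"
      using u by (metis carrier_vecD eq_vecI index_zero_vec)
    have col: "col (ketbra u u) j = cnj (u $ j) \<cdot>\<^sub>v u"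
      using u j by (intro eq_vecI) (auto simp: ketbra_def)
    have "lin_indpt {}" by (simp add: lin_dep_def)
    moreover have "cnj (u $ j) \<cdot>\<^sub>v u \<notin> span {}"
      using u j by (auto simp: span_empty vec_eq_iff)
    ultimately have "lin_indpt {cnj (u $ j) \<cdot>\<^sub>v u}"
      using lin_dep_iff_in_span[of "{}" "cnj (u $ j) \<cdot>\<^sub>v u"] u by auto
    moreover have "cnj (u $ j) \<cdot>\<^sub>v u \<in> set (cols (ketbra u u))"
      using u j by (auto simp: cols_def ketbra_def simp flip: col intro!: image_eqI[of _ _ j])
    ultimately have "card {cnj (u $ j) \<cdot>\<^sub>v u} \<le> rank (ketbra u u)"
      using u by (intro rank_ge_card_indpt[of _ d]) (auto simp: ketbra_def)
    then show False using \<open>rank (ketbra u u) = 0\<close> by simp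
  qed
  ultimately show ?thesis by linarith
qed

lemma rank_one_projection_ketbra:
  assumes "u \<in> carrier_vec d" "u \<bullet>c u = 1"
  shows "rank_one_projection d (ketbra u u)"
  using assms by (simp add: rank_one_projection_def orth_projection_ketbra rank_ketbra)

text \<open>The double sum over row and column indices factors into the inner product and its
  conjugate.\<close>

lemma trace_ketbra_mult_ketbra:
  assumes u: "u \<in> carrier_vec d" and v: "v \<in> carrier_vec d"
  shows "mat_trace (ketbra u u * ketbra v v) = of_real ((cmod (u \<bullet>c v))\<^sup>2)"
proof -
  have "mat_trace (ketbra u u * ketbra v v)
      = (\<Sum>i<d. \<Sum>k<d. u $ i * cnj (v $ i) * (cnj (u $ k) * v $ k))"
    using u v unfolding mat_trace_def
    by (intro sum.cong) (auto simp: ketbra_def scalar_prod_def lessThan_atLeast0 mult_ac intro!: sum.cong)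
  also have "\<dots> = (u \<bullet>c v) * cnj (u \<bullet>c v)"
    using u v by (simp add: scalar_prod_def sum_product lessThan_atLeast0 )
  finally show ?thesis by (simp only: complex_norm_square)
qed

section \<open>Eigenvectors of the Weyl unitaries\<close>

lemma root_of_unity_power: "root_of_unity d ^ k = phase d (2 * int k)"
proof -
  have "root_of_unity d = phase d 2"
    unfolding root_of_unity_def phase_def cis_conv_exp
    by (intro arg_cong[of _ _ exp]) simp
  then show ?thesis by (simp add: phase_power mult.commute)
qed

lemma inj_on_add_mod: "inj_on (\<lambda>k. (n + k) mod d) {..<d :: nat}"
proof (rule inj_onI)
  fix k l assume "k \<in> {..<d}" "l \<in> {..<d}" "(n + k) mod d = (n + l) mod d"
  then show "k = l"
    by (metis cong_add_lcancel_nat cong_def cong_less_modulus_unique_nat lessThan_iff)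
qed

text \<open>Reading the image at the place to which entry \<open>k\<close> is moved avoids
  subtraction modulo \<open>d\<close>. Translation is injective, so that row of the matrix has its
  only nonzero entry in column \<open>k\<close>.\<close>

lemma weyl_mult_vec_index:
  assumes v: "v \<in> carrier_vec d" and k: "k < d"
  shows "(weyl d m n *\<^sub>v v) $ ((n + k) mod d) = phase d (2 * (int m * int k)) * v $ k"
proof -
  have "(weyl d m n *\<^sub>v v) $ ((n + k) mod d)
      = (\<Sum>l<d. (if k = l then root_of_unity d ^ (m * l) else 0) * v $ l)"
    using v k unfolding weyl_def
    by (simp add: scalar_prod_def lessThan_atLeast0[symmetric] inj_on_eq_iff[OF inj_on_add_mod])
  also have "\<dots> = (\<Sum>l<d. if l = k then root_of_unity d ^ (m * k) * v $ k else 0)"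
    by (intro sum.cong) auto
  finally show ?thesis using k by (simp add: root_of_unity_power)
qed

text \<open>Turns the eigenvalue equation into a recurrence along the cycles of translation by
  \<open>n\<close>. For the converse, every coordinate is reached because translation is
  onto.\<close>

lemma weyl_eigen_iff:
  assumes v: "v \<in> carrier_vec d"
  shows "weyl d m n *\<^sub>v v = l \<cdot>\<^sub>v v \<longleftrightarrow>
    (\<forall>k<d. phase d (2 * (int m * int k)) * v $ k = l * v $ ((n + k) mod d))"
    (is "?L \<longleftrightarrow> ?R")
proof
  assume L: ?L
  show ?R
  proof safe
    fix k assume k: "k < d"
    have "(n + k) mod d < d" using k by simp
    then have "(l \<cdot>\<^sub>v v) $ ((n + k) mod d) = l * v $ ((n + k) mod d)" using v by simp
    then show "phase d (2 * (int m * int k)) * v $ k = l * v $ ((n + k) mod d)"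
      using weyl_mult_vec_index[OF v k, of m n] L by simp
  qed
next
  assume R: ?R
  have surj: "(\<lambda>k. (n + k) mod d) ` {..<d} = {..<d}"
    by (rule endo_inj_surj[OF _ _ inj_on_add_mod]) auto
  show ?L
  proof (rule eq_vecI)
    fix j assume "j < dim_vec (l \<cdot>\<^sub>v v)"
    then have j: "j < d" using v by simp
    then have "j \<in> (\<lambda>k. (n + k) mod d) ` {..<d}" using surj by simp
    then obtain k where k: "k < d" "j = (n + k) mod d" by auto
    have "(weyl d m n *\<^sub>v v) $ j = l * v $ j"
      using weyl_mult_vec_index[OF v k(1), of m n] R k by simp
    then show "(weyl d m n *\<^sub>v v) $ j = (l \<cdot>\<^sub>v v) $ j" using v j by simp
  qed (use v in \<open>simp add: weyl_def\<close>)
qed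

section \<open>Eigenvectors of the unitaries U_{m,1}\<close>

definition shift_phase :: "nat \<Rightarrow> int \<Rightarrow> int \<Rightarrow> nat \<Rightarrow> complex" where
  "shift_phase p m c k = phase (p\<^sup>2) (m * (int k * (int k - int p)) - 2 * (int k * c))"

definition shift_vec :: "nat \<Rightarrow> int \<Rightarrow> int \<Rightarrow> complex vec" where
  "shift_vec p m c = vec (p\<^sup>2) (\<lambda>k. shift_phase p m c k / of_nat p)"

lemma shift_vec_carrier [simp]: "shift_vec p m c \<in> carrier_vec (p\<^sup>2)"
  by (simp add: shift_vec_def)

lemma shift_phase_0 [simp]: "shift_phase p m c 0 = 1"
  by (simp add: shift_phase_def)

lemma norm_shift_phase [simp]: "cmod (shift_phase p m c k) = 1"
  by (simp add: shift_phase_def)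

text \<open>The exponent in \<open>shift_phase\<close> is the sum over j < k of 2mj - m(p - 1) - 2c,
  the increments dictated by the recurrence with eigenvalue exponent m(p - 1) + 2c.\<close>

lemma shift_phase_Suc:
  "phase (p\<^sup>2) (2 * (m * int k)) * shift_phase p m c k =
   phase (p\<^sup>2) (m * (int p - 1) + 2 * c) * shift_phase p m c (Suc k)"
  unfolding shift_phase_def phase_add[symmetric]
  by (intro arg_cong[of _ _ "phase (p\<^sup>2)"]) (simp add: algebra_simps)

text \<open>Closes the recurrence after a full cycle. It works for \<open>p = 2\<close> as well,
  since p^2 - p is always even.\<close>

lemma shift_phase_wrap:
  assumes "p > 0"
  shows "shift_phase p m c (p\<^sup>2) = 1"
proof -
  have "shift_phase p m c (p\<^sup>2) = phase (p\<^sup>2) (int (p\<^sup>2) * (m * (int (p\<^sup>2) - int p) - 2 * c))"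
    unfolding shift_phase_def by (simp add: algebra_simps)
  also have "\<dots> = 1"
    by (rule phase_eq_1) (use assms in simp_all)
  finally show ?thesis .
qed

text \<open>Translation by 1 links all coordinates in one cycle, so entry 0 determines an
  eigenvector and the eigenspace is a line.\<close>

lemma eigenspace_shift:
  assumes p: "p > 0"
  shows "eigenspace (p\<^sup>2) (weyl (p\<^sup>2) m 1) (phase (p\<^sup>2) (int m * (int p - 1) + 2 * c))
    = {z \<cdot>\<^sub>v shift_vec p (int m) c | z. True}"
proof -
  let ?l = "phase (p\<^sup>2) (int m * (int p - 1) + 2 * c)" and ?f = "shift_phase p (int m) c"
  let ?u = "shift_vec p (int m) c"
  have d: "p\<^sup>2 > 0" using p by simp
  have "\<exists>z. v = z \<cdot>\<^sub>v ?u"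
    if v: "v \<in> carrier_vec (p\<^sup>2)" and ev: "weyl (p\<^sup>2) m 1 *\<^sub>v v = ?l \<cdot>\<^sub>v v" for v
  proof -
    have val: "v $ k = v $ 0 * ?f k" if "k < p\<^sup>2" for k
      using that
    proof (induction k)
      case (Suc k)
      have "?l * v $ Suc k = phase (p\<^sup>2) (2 * (int m * int k)) * v $ k"
        using weyl_eigen_iff[OF v, of m 1 ?l] ev Suc.prems by simp
      also have "\<dots> = v $ 0 * (phase (p\<^sup>2) (2 * (int m * int k)) * ?f k)"
        using Suc by simp
      also have "\<dots> = ?l * (v $ 0 * ?f (Suc k))"
        unfolding shift_phase_Suc by (rule mult.left_commute)
      finally show ?case by simp
    qed simp
    have "v = (v $ 0 * of_nat p) \<cdot>\<^sub>v ?u"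
    proof (rule eq_vecI)
      fix k assume "k < dim_vec ((v $ 0 * of_nat p) \<cdot>\<^sub>v ?u)"
      then have k: "k < p\<^sup>2" by (simp add: shift_vec_def)
      show "v $ k = ((v $ 0 * of_nat p) \<cdot>\<^sub>v ?u) $ k"
        by (subst val[OF k]) (use k p in \<open>simp add: shift_vec_def\<close>)
    qed (use v in \<open>simp add: shift_vec_def\<close>)
    then show ?thesis ..
  qed
  moreover have "weyl (p\<^sup>2) m 1 *\<^sub>v (z \<cdot>\<^sub>v ?u) = ?l \<cdot>\<^sub>v (z \<cdot>\<^sub>v ?u)" for z
  proof (subst weyl_eigen_iff, simp, safe)
    fix k assume k: "k < p\<^sup>2"
    \<comment> \<open>Only the last coordinate wraps around, and there the values at
      \<open>p^2\<close> and at 0 agree.\<close>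
    have "?f ((1 + k) mod p\<^sup>2) = ?f (Suc k)"
      using k p by (cases "Suc k = p\<^sup>2") (simp_all add: shift_phase_wrap)
    then show "phase (p\<^sup>2) (2 * (int m * int k)) * (z \<cdot>\<^sub>v ?u) $ k
        = ?l * (z \<cdot>\<^sub>v ?u) $ ((1 + k) mod p\<^sup>2)"
      using k d shift_phase_Suc[of p "int m" k c] by (simp add: shift_vec_def)
  qed
  ultimately show ?thesis by (auto simp: eigenspace_def)
qed

text \<open>The labels \<open>c\<close> and \<open>s\<close> merge into the single number
  \<open>c + p * s\<close>, because 1/p is p/p^2.\<close>

lemma gam_eq_phase:
  assumes p: "p > 0"
  shows "gam p r a c s =
    phase (p\<^sup>2) (int (a * p + r) * (int p - 1) + 2 * int (c + p * s))"
proof -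
  have "exp (of_real pi * \<i> / of_nat (p\<^sup>2) * of_nat (a * p + r) * (of_nat p - 1))
      = phase (p\<^sup>2) (int (a * p + r) * (int p - 1))"
    unfolding phase_def cis_conv_exp by (intro arg_cong[of _ _ exp]) simp
  moreover have "exp (2 * of_real pi * \<i> * of_nat c / of_nat (p\<^sup>2)) = phase (p\<^sup>2) (2 * int c)"
    unfolding phase_def cis_conv_exp by (intro arg_cong[of _ _ exp]) simp
  moreover have "exp (2 * of_real pi * \<i> * of_nat s / of_nat p) = phase (p\<^sup>2) (2 * (int p * int s))"
    unfolding phase_def cis_conv_exp
    by (intro arg_cong[of _ _ exp]) (use p in \<open>simp add: power2_eq_square\<close>)
  ultimately show ?thesis
    unfolding gam_def by (simp add: algebra_simps flip: phase_add)
qed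

section \<open>Eigenvectors of the unitaries U_{1,bp} on the spans E_t\<close>

definition block_vec :: "nat \<Rightarrow> nat \<Rightarrow> int \<Rightarrow> int \<Rightarrow> complex vec" where
  "block_vec p t \<alpha> \<beta> = vec (p\<^sup>2)
     (\<lambda>k. if k mod p = t then quad_phase p \<alpha> \<beta> (int (k div p)) / of_real (sqrt (of_nat p)) else 0)"

lemma block_vec_carrier [simp]: "block_vec p t \<alpha> \<beta> \<in> carrier_vec (p\<^sup>2)"
  by (simp add: block_vec_def)

lemma dim_block_vec [simp]: "dim_vec (block_vec p t \<alpha> \<beta>) = p\<^sup>2"
  by (simp add: block_vec_def)

lemma block_index_less:
  fixes p :: nat
  assumes "v < p" "t < p"
  shows "v * p + t < p\<^sup>2"
proof -
  have "v * p + t < Suc v * p" using assms by simp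
  also have "\<dots> \<le> p * p" using assms by (intro mult_right_mono) auto
  finally show ?thesis by (simp add: power2_eq_square)
qed

lemma block_indexE:
  fixes p :: nat
  assumes "k < p\<^sup>2"
  obtains v where "k = v * p + k mod p" "v < p" "k mod p < p"
  using assms that[of "k div p"] by (cases "p = 0") (auto simp: power2_eq_square less_mult_imp_div_less)

text \<open>Replaces the span by a condition on coordinates, the form in which the recurrence on a
  block can be used.\<close>

lemma E_space_iff:
  assumes t: "t < p"
  shows "v \<in> E_space p t \<longleftrightarrow> v \<in> carrier_vec (p\<^sup>2) \<and> (\<forall>k<p\<^sup>2. k mod p \<noteq> t \<longrightarrow> v $ k = 0)"
proof -
  interpret vec_space "TYPE(complex)" "p\<^sup>2" .
  let ?e = "\<lambda>v. unit_vec (p\<^sup>2) (v * p + t) :: complex vec"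
  let ?A = "?e ` {..<p}"
  have A: "?A \<subseteq> carrier_vec (p\<^sup>2)" "finite ?A" by auto
  have idx: "w * p + t < p\<^sup>2" if "w < p" for w using block_index_less that t by blast
  have inj: "inj_on ?e {..<p}"
  proof (rule inj_onI)
    fix x y assume xy: "x \<in> {..<p}" "y \<in> {..<p}" "?e x = ?e y"
    then have "?e x $ (y * p + t) = 1" using idx by simp
    then have "y * p + t = x * p + t" using idx[of y] idx[of x] xy by (simp split: if_splits)
    then show "x = y" using t by simp
  qed
  show ?thesis
  proof
    assume "v \<in> E_space p t"
    then have "v \<in> span ?A" by (simp add: E_space_def)
    then obtain a where v: "v = lincomb a ?A"
      using A finite_span[of ?A] by auto
    have "v \<in> carrier_vec (p\<^sup>2)" unfolding v using A by auto
    moreover have "v $ k = 0" if k: "k < p\<^sup>2" "k mod p \<noteq> t" for k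
    proof -
      have "x $ k = 0" if "x \<in> ?A" for x
        using that k idx t by auto
      then show ?thesis unfolding v using lincomb_index[OF k(1) A(1)] by simp
    qed
    ultimately show "v \<in> carrier_vec (p\<^sup>2) \<and> (\<forall>k<p\<^sup>2. k mod p \<noteq> t \<longrightarrow> v $ k = 0)" by blast
  next
    assume v: "v \<in> carrier_vec (p\<^sup>2) \<and> (\<forall>k<p\<^sup>2. k mod p \<noteq> t \<longrightarrow> v $ k = 0)"
    \<comment> \<open>Coefficients of \<open>lincomb\<close> depend on vectors, not on indices; the
      scalar product with a unit vector recovers the entry of \<open>v\<close>.\<close>
    define a where "a x = v \<bullet> x" for x
    have "v = lincomb a ?A"
    proof (rule eq_vecI)
      have car: "lincomb a ?A \<in> carrier_vec (p\<^sup>2)" using A by auto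
      show "dim_vec v = dim_vec (lincomb a ?A)" using car v by auto
      fix k assume "k < dim_vec (lincomb a ?A)"
      then have k: "k < p\<^sup>2" using car by auto
      then obtain w where w: "k = w * p + k mod p" "w < p" by (rule block_indexE)
      have "lincomb a ?A $ k = (\<Sum>x<p. a (?e x) * ?e x $ k)"
        using lincomb_index[OF k A(1)] by (simp add: sum.reindex[OF inj])
      also have "\<dots> = (\<Sum>x<p. if x = w \<and> k mod p = t then v $ k else 0)"
      proof (intro sum.cong refl)
        fix x assume "x \<in> {..<p}"
        moreover have "k = x * p + t \<longleftrightarrow> x = w \<and> k mod p = t"
        proof
          assume k': "k = x * p + t"
          then have "k mod p = t" using t by simp
          then have "w * p = x * p" using k' w by simp
          then show "x = w \<and> k mod p = t" using \<open>k mod p = t\<close> t by simp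
        qed (use w in auto)
        ultimately show "a (?e x) * ?e x $ k = (if x = w \<and> k mod p = t then v $ k else 0)"
          using idx[of x] k v by (auto simp: a_def)
      qed
      also have "\<dots> = v $ k" using w v k by (cases "k mod p = t") auto
      finally show "v $ k = lincomb a ?A $ k" by simp
    qed
    then show "v \<in> E_space p t"
      unfolding E_space_def using A finite_span[of ?A] by auto
  qed
qed

lemma E_space_carrier: "t < p \<Longrightarrow> v \<in> E_space p t \<Longrightarrow> v \<in> carrier_vec (p\<^sup>2)"
  by (simp add: E_space_iff)

text \<open>At the index \<open>x * p + t\<close> the phase splits into one of level p^2 depending
  on \<open>t\<close> only, which is cancelled from the eigenvalue, and one of level p in
  \<open>x\<close>. Translation by \<open>b * p\<close> keeps \<open>t\<close> and moves
  \<open>x\<close> by \<open>b\<close> modulo \<open>p\<close>.\<close>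

lemma weyl_block_eigen_iff:
  assumes t: "t < p" and v: "v \<in> E_space p t"
  shows "weyl (p\<^sup>2) 1 (b * p) *\<^sub>v v = (phase (p\<^sup>2) (2 * int t) * \<kappa>) \<cdot>\<^sub>v v \<longleftrightarrow>
    (\<forall>x<p. phase p (2 * int x) * v $ (x * p + t) = \<kappa> * v $ ((x + b) mod p * p + t))"
proof -
  have v': "v \<in> carrier_vec (p\<^sup>2)" and zero: "\<And>k. k < p\<^sup>2 \<Longrightarrow> k mod p \<noteq> t \<Longrightarrow> v $ k = 0"
    using v by (auto simp: E_space_iff[OF t])
  have p: "p > 0" using t by simp
  have root: "phase (p\<^sup>2) (2 * int (x * p + y)) = phase (p\<^sup>2) (2 * int y) * phase p (2 * int x)" for x y
  proof -
    have "2 * int (x * p + y) = 2 * int y + int p * (2 * int x)" by simp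
    then show ?thesis
      using phase_reduce[OF p, of p "2 * int x"] by (simp only: power2_eq_square phase_add)
  qed
  have wrap: "(b * p + (x * p + y)) mod p\<^sup>2 = (x + b) mod p * p + y" if "y < p" for x y
  proof -
    have "b * p + (x * p + y) = (x + b) * p + y" by (simp add: algebra_simps)
    then show ?thesis
      using that mod_mult2_eq[of "(x + b) * p + y" p p] by (simp only: power2_eq_square) simp
  qed
  let ?l = "phase (p\<^sup>2) (2 * int t) * \<kappa>"
  have "weyl (p\<^sup>2) 1 (b * p) *\<^sub>v v = ?l \<cdot>\<^sub>v v \<longleftrightarrow>
    (\<forall>k<p\<^sup>2. phase (p\<^sup>2) (2 * int k) * v $ k = ?l * v $ ((b * p + k) mod p\<^sup>2))"
    by (simp add: weyl_eigen_iff[OF v'])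
  also have "\<dots> \<longleftrightarrow> (\<forall>x<p. \<forall>y<p. phase (p\<^sup>2) (2 * int (x * p + y)) * v $ (x * p + y)
      = ?l * v $ ((x + b) mod p * p + y))"
    (is "?L \<longleftrightarrow> ?R")
  proof
    assume L: ?L
    show ?R
    proof safe
      fix x y assume "x < p" "y < p"
      then show "phase (p\<^sup>2) (2 * int (x * p + y)) * v $ (x * p + y) = ?l * v $ ((x + b) mod p * p + y)"
        using L[rule_format, OF block_index_less, of x y] by (simp only: wrap)
    qed
  next
    assume R: ?R
    show ?L
    proof safe
      fix k assume "k < p\<^sup>2"
      then obtain x where x: "k = x * p + k mod p" "x < p" "k mod p < p" by (rule block_indexE)
      show "phase (p\<^sup>2) (2 * int k) * v $ k = ?l * v $ ((b * p + k) mod p\<^sup>2)"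
        using R[rule_format, OF x(2,3)] unfolding wrap[OF x(3), symmetric] x(1)[symmetric] .
    qed
  qed
  \<comment> \<open>For residues other than \<open>t\<close> both sides are zero.\<close>
  also have "\<dots> \<longleftrightarrow> (\<forall>x<p. phase (p\<^sup>2) (2 * int (x * p + t)) * v $ (x * p + t)
      = ?l * v $ ((x + b) mod p * p + t))"
  proof -
    have "phase (p\<^sup>2) (2 * int (x * p + y)) * v $ (x * p + y) = ?l * v $ ((x + b) mod p * p + y)"
      if "x < p" "y < p" "y \<noteq> t" for x y
      using that p zero[OF block_index_less, of x y] zero[OF block_index_less, of "(x + b) mod p" y]
      by simp
    then show ?thesis using t by blast
  qed
  also have "\<dots> \<longleftrightarrow> (\<forall>x<p. phase p (2 * int x) * v $ (x * p + t) = \<kappa> * v $ ((x + b) mod p * p + t))"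
    unfolding root by (simp add: mult.assoc)
  finally show ?thesis .
qed

lemma quad_phase_mod:
  assumes "n > 0" "even (\<alpha> * int n + \<beta>)"
  shows "quad_phase n \<alpha> \<beta> (int (x mod n)) = quad_phase n \<alpha> \<beta> (int x)"
proof (induction x rule: less_induct)
  case (less x)
  show ?case
  proof (cases "x < n")
    case False
    then have "quad_phase n \<alpha> \<beta> (int ((x - n) mod n)) = quad_phase n \<alpha> \<beta> (int (x - n))"
      using less assms(1) by simp
    moreover have x: "int x = int (x - n) + int n" using False by simp
    have "quad_phase n \<alpha> \<beta> (int x) = quad_phase n \<alpha> \<beta> (int (x - n))"
      by (subst x) (rule quad_phase_periodic[OF assms])
    ultimately show ?thesis using False by (metis le_mod_geq not_less)
  qed simp
qed

text \<open>Replacing \<open>x\<close> by \<open>x + b\<close> adds the cross term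
  \<open>2 * \<alpha> * b * x\<close> to the exponent. Since \<open>\<alpha>\<close> inverts
  \<open>b\<close>, this is \<open>2 * x\<close> up to an even multiple of \<open>n\<close>, and the
  rest is constant in \<open>x\<close>.\<close>

lemma quad_phase_shift:
  assumes n: "n > 0" and cong: "[\<alpha> * int b = 1] (mod int n)" and ev: "even (\<alpha> * int n + \<beta>)"
  shows "phase n (2 * int x) * quad_phase n \<alpha> \<beta> (int x) =
    phase n (- (\<alpha> * (int b)\<^sup>2 + \<beta> * int b)) * quad_phase n \<alpha> \<beta> (int ((x + b) mod n))"
proof -
  obtain k where k: "\<alpha> * int b = 1 + int n * k"
    using cong by (metis cong_iff_lin cong_sym)
  have "2 * \<alpha> * int b * int x = 2 * (1 + int n * k) * int x"
    by (simp only: mult.assoc k)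
  then show ?thesis
    unfolding quad_phase_mod[OF n ev] unfolding quad_phase_def phase_add[symmetric]
    by (intro phase_cong[OF n, of "- 2 * k * int x"]) (auto simp: power2_eq_square algebra_simps)
qed

text \<open>The quotient of any solution by the known one is invariant under \<open>x\<close> to
  \<open>x + b\<close> modulo \<open>p\<close>. As \<open>b\<close> is invertible, its multiples
  reach every residue, so the quotient is constant.\<close>

lemma block_eigen_line:
  assumes t: "t < p" and cong: "[\<alpha> * int b = 1] (mod int p)" and ev: "even (\<alpha> * int p + \<beta>)"
  shows "eigenspace (p\<^sup>2) (weyl (p\<^sup>2) 1 (b * p))
      (phase (p\<^sup>2) (2 * int t) * phase p (- (\<alpha> * (int b)\<^sup>2 + \<beta> * int b))) \<inter> E_space p t
    = {z \<cdot>\<^sub>v block_vec p t \<alpha> \<beta> | z. True}"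
    (is "eigenspace _ ?U (_ * ?\<kappa>) \<inter> _ = _")
proof -
  let ?l = "phase (p\<^sup>2) (2 * int t) * ?\<kappa>"
  let ?q = "\<lambda>x :: nat. quad_phase p \<alpha> \<beta> (int x)" and ?u = "block_vec p t \<alpha> \<beta>"
  have p: "p > 0" using t by simp
  have shift: "phase p (2 * int x) * ?q x = ?\<kappa> * ?q ((x + b) mod p)" for x
    by (rule quad_phase_shift[OF p cong ev])
  have nz [simp]: "?q x \<noteq> 0" for x by (simp add: quad_phase_def)
  have u: "?u $ (x * p + t) = ?q x / of_real (sqrt (of_nat p))" if "x < p" for x
    using that t block_index_less[of x p t] by (simp add: block_vec_def)
  have "\<exists>z. v = z \<cdot>\<^sub>v ?u" if ev: "?U *\<^sub>v v = ?l \<cdot>\<^sub>v v" and v: "v \<in> E_space p t" for v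
  proof -
    define y where "y x = v $ (x * p + t) / ?q x" for x
    have step: "y ((x + b) mod p) = y x" if "x < p" for x
    proof -
      have "phase p (2 * int x) * v $ (x * p + t) = ?\<kappa> * v $ ((x + b) mod p * p + t)"
        using weyl_block_eigen_iff[OF t v, of b ?\<kappa>] ev that by simp
      then have "phase p (2 * int x) * ?q x * y x = ?\<kappa> * ?q ((x + b) mod p) * y ((x + b) mod p)"
        by (simp add: y_def)
      then show ?thesis by (simp add: shift)
    qed
    have orbit: "y ((j * b) mod p) = y 0" for j
    proof (induction j)
      case (Suc j)
      have "Suc j * b mod p = ((j * b) mod p + b) mod p"
        by (simp add: mod_simps add.commute)
      then show ?case using Suc step[of "(j * b) mod p"] p by simp
    qed simp
    have const: "y x = y 0" if "x < p" for x
    proof -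
      \<comment> \<open>The number of steps of length \<open>b\<close> that lead from 0 to
        \<open>x\<close>.\<close>
      define j where "j = nat ((int x * \<alpha>) mod int p)"
      have "[int (j * b) = int x * \<alpha> * int b] (mod int p)"
        using p by (simp add: j_def cong_def mod_simps)
      also have "[int x * \<alpha> * int b = int x * 1] (mod int p)"
        unfolding mult.assoc by (rule cong_mult[OF cong_refl cong])
      finally have "[j * b = x] (mod p)" by (simp flip: cong_int_iff)
      then have "(j * b) mod p = x" using that by (simp add: cong_def)
      then show ?thesis using orbit[of j] by simp
    qed
    have "v = (y 0 * of_real (sqrt (of_nat p))) \<cdot>\<^sub>v ?u"
    proof (rule eq_vecI)
      have v': "v \<in> carrier_vec (p\<^sup>2)" using E_space_carrier[OF t v] .
      show "dim_vec v = dim_vec ((y 0 * of_real (sqrt (of_nat p))) \<cdot>\<^sub>v ?u)"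
        using v' by (simp add: block_vec_def)
      fix k assume "k < dim_vec ((y 0 * of_real (sqrt (of_nat p))) \<cdot>\<^sub>v ?u)"
      then have k: "k < p\<^sup>2" by (simp add: block_vec_def)
      then obtain x where x: "k = x * p + k mod p" "x < p" by (rule block_indexE)
      show "v $ k = ((y 0 * of_real (sqrt (of_nat p))) \<cdot>\<^sub>v ?u) $ k"
      proof (cases "k mod p = t")
        case True
        have "v $ (x * p + t) = y 0 * ?q x" using const[OF x(2)] by (simp add: y_def field_simps)
        then show ?thesis using x k p True u[OF x(2)] by simp
      next
        case False
        then show ?thesis using v k by (simp add: E_space_iff[OF t] block_vec_def)
      qed
    qed
    then show ?thesis ..
  qed
  moreover have mem: "z \<cdot>\<^sub>v ?u \<in> E_space p t" for z
    by (auto simp: E_space_iff[OF t] block_vec_def)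
  moreover have "?U *\<^sub>v (z \<cdot>\<^sub>v ?u) = ?l \<cdot>\<^sub>v (z \<cdot>\<^sub>v ?u)" for z
  proof (subst weyl_block_eigen_iff[OF t mem], safe)
    fix x assume x: "x < p"
    have "(z \<cdot>\<^sub>v ?u) $ (y * p + t) = z * ?q y / of_real (sqrt (of_nat p))" if "y < p" for y
      using u[OF that] block_index_less[OF that t] by simp
    then show "phase p (2 * int x) * (z \<cdot>\<^sub>v ?u) $ (x * p + t)
        = ?\<kappa> * (z \<cdot>\<^sub>v ?u) $ ((x + b) mod p * p + t)"
      using x p shift[of x] by simp
  qed
  ultimately show ?thesis by (auto simp: eigenspace_def)
qed

section \<open>Inner products, summed block by block\<close>

lemma sum_blocks:
  fixes f :: "nat \<Rightarrow> 'a :: comm_monoid_add"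
  shows "(\<Sum>k<p\<^sup>2. f k) = (\<Sum>t<p. \<Sum>v<p. f (v * p + t))"
proof -
  have "(\<Sum>k<p\<^sup>2. f k) = (\<Sum>v<p. \<Sum>k=v * p..<v * p + p. f k)"
    by (simp add: sum.nat_group power2_eq_square)
  also have "\<dots> = (\<Sum>v<p. \<Sum>t<p. f (v * p + t))"
    by (simp add: sum.atLeastLessThan_shift_0[of _ "_ * p"] lessThan_atLeast0)
  finally show ?thesis by (subst sum.swap)
qed

text \<open>For k = vp + t one has k(k - p) = p^2 v(v - 1) + 2ptv + t(t - p). The quadratic term
  drops out because v(v - 1) is even, which leaves a phase linear in \<open>v\<close>.\<close>

lemma shift_phase_block:
  assumes p: "p > 0"
  shows "shift_phase p m c (v * p + t) = shift_phase p m c t * phase p (2 * ((m * int t - c) * int v))"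
proof -
  have "shift_phase p m c t * phase p (2 * ((m * int t - c) * int v))
      = phase (p\<^sup>2) (m * (int t * (int t - int p)) - 2 * (int t * c) + int p * (2 * ((m * int t - c) * int v)))"
    using phase_reduce[OF p, of p] by (simp add: phase_add shift_phase_def power2_eq_square)
  moreover have "shift_phase p m c (v * p + t) = \<dots>"
    unfolding shift_phase_def using p
    by (intro phase_cong[of _ "m * (int v * (int v - 1))"]) (simp_all add: power2_eq_square algebra_simps)
  ultimately show ?thesis by simp
qed

lemma shift_phase_mult_cnj:
  "shift_phase p m c k * cnj (shift_phase p m' c' k) = shift_phase p (m - m') (c - c') k"
  by (simp add: shift_phase_def phase_mult_cnj) (simp add: algebra_simps)

text \<open>Each block contributes a complete geometric sum, which is \<open>p\<close> or 0; one of
  the two normalising factors \<open>p\<close> cancels.\<close>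

lemma shift_inner_shift:
  assumes p: "p > 0"
  shows "shift_vec p m c \<bullet>c shift_vec p m' c' =
    (\<Sum>t<p. if int p dvd (m - m') * int t - (c - c') then shift_phase p (m - m') (c - c') t else 0) / of_nat p"
proof -
  have "shift_vec p m c \<bullet>c shift_vec p m' c' = (\<Sum>k<p\<^sup>2. shift_phase p (m - m') (c - c') k) / of_nat p / of_nat p"
    unfolding shift_phase_mult_cnj[symmetric]
    by (simp add: scalar_prod_def shift_vec_def sum_divide_distrib lessThan_atLeast0)
  also have "(\<Sum>k<p\<^sup>2. shift_phase p (m - m') (c - c') k)
      = (\<Sum>t<p. if int p dvd (m - m') * int t - (c - c') then shift_phase p (m - m') (c - c') t else 0) * of_nat p"
    unfolding sum_blocks shift_phase_block[OF p] sum_distrib_left[symmetric] sum_phase[OF p] sum_distrib_right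
    by (intro sum.cong) auto
  finally show ?thesis using p by simp
qed

lemma block_inner_block:
  assumes t: "t < p" "t' < p"
  shows "block_vec p t \<alpha> \<beta> \<bullet>c block_vec p t' \<alpha>' \<beta>' =
    (if t = t' then (\<Sum>v<p. quad_phase p (\<alpha> - \<alpha>') (\<beta> - \<beta>') (int v)) / of_nat p else 0)"
proof -
  have q: "quad_phase p \<alpha> \<beta> v * cnj (quad_phase p \<alpha>' \<beta>' v) = quad_phase p (\<alpha> - \<alpha>') (\<beta> - \<beta>') v" for v
    by (simp add: quad_phase_def phase_mult_cnj) (simp add: algebra_simps)
  have s: "of_real (sqrt (real p)) * of_real (sqrt (real p)) = (of_nat p :: complex)"
    by (simp flip: of_real_mult)
  have "block_vec p t \<alpha> \<beta> \<bullet>c block_vec p t' \<alpha>' \<beta>' = (\<Sum>k<p\<^sup>2. block_vec p t \<alpha> \<beta> $ k * cnj (block_vec p t' \<alpha>' \<beta>' $ k))"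
    by (simp add: scalar_prod_def block_vec_def lessThan_atLeast0)
  also have "\<dots> = (\<Sum>y<p. \<Sum>v<p. block_vec p t \<alpha> \<beta> $ (v * p + y) * cnj (block_vec p t' \<alpha>' \<beta>' $ (v * p + y)))"
    by (rule sum_blocks)
  also have "\<dots> = (\<Sum>y<p. if y = t then (if t = t' then (\<Sum>v<p. quad_phase p (\<alpha> - \<alpha>') (\<beta> - \<beta>') (int v)) / of_nat p else 0) else 0)"
    unfolding sum_divide_distrib
    by (intro sum.cong refl) (auto simp: block_vec_def block_index_less q[symmetric] s intro!: sum.cong sum.neutral)
  finally show ?thesis using t by simp
qed

text \<open>Only block \<open>t\<close> contributes. There the linear phase of one vector joins the
  conjugated quadratic phase of the other.\<close>

lemma shift_inner_block:
  assumes t: "t < p" 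
  shows "shift_vec p m c \<bullet>c block_vec p t \<alpha> \<beta> =
    shift_phase p m c t * (\<Sum>v<p. quad_phase p (- \<alpha>) (2 * (m * int t - c) - \<beta>) (int v)) / (of_nat p * of_real (sqrt (of_nat p)))"
proof -
  have p: "p > 0" using t by simp
  define \<gamma> where "\<gamma> = 2 * (m * int t - c) - \<beta>"
  have q: "phase p (2 * ((m * int t - c) * v)) * cnj (quad_phase p \<alpha> \<beta> v) = quad_phase p (- \<alpha>) \<gamma> v" for v
    by (simp add: \<gamma>_def quad_phase_def phase_mult_cnj) (simp add: algebra_simps)
  have "shift_vec p m c \<bullet>c block_vec p t \<alpha> \<beta> = (\<Sum>k<p\<^sup>2. shift_vec p m c $ k * cnj (block_vec p t \<alpha> \<beta> $ k))"
    by (simp add: scalar_prod_def block_vec_def lessThan_atLeast0)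
  also have "\<dots> = (\<Sum>y<p. \<Sum>v<p. shift_vec p m c $ (v * p + y) * cnj (block_vec p t \<alpha> \<beta> $ (v * p + y)))"
    by (rule sum_blocks)
  also have "\<dots> = (\<Sum>y<p. if y = t then shift_phase p m c t * (\<Sum>v<p. quad_phase p (- \<alpha>) \<gamma> (int v)) / (of_nat p * of_real (sqrt (of_nat p))) else 0)"
    unfolding sum_divide_distrib sum_distrib_left
    by (intro sum.cong refl)
      (auto simp: block_vec_def shift_vec_def block_index_less q[symmetric] shift_phase_block[OF p] mult_ac intro!: sum.cong)
  finally show ?thesis using t by (simp add: \<gamma>_def)
qed

section \<open>Overlaps\<close>

text \<open>By \<open>trace_ketbra_mult_ketbra\<close>, the real number whose complex embedding is
  the trace of the product of the two projections.\<close>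

definition overlap :: "complex vec \<Rightarrow> complex vec \<Rightarrow> real" where
  "overlap u v = (cmod (u \<bullet>c v))\<^sup>2"

lemma overlap_commute:
  assumes "u \<in> carrier_vec d" "v \<in> carrier_vec d"
  shows "overlap u v = overlap v u"
proof -
  have "v \<bullet>c u = cnj (u \<bullet>c v)"
    using assms by (simp add: scalar_prod_def mult.commute)
  then show ?thesis by (simp add: overlap_def)
qed

lemma prime_coprime_int:
  assumes "prime p" "\<not> int p dvd a"
  shows "coprime a (int p)"
  using assms by (metis coprime_commute prime_imp_coprime prime_nat_int_transfer)

lemma coprime_cong_solve:
  assumes "coprime a (int n)" "n > 0"
  obtains t where "t < n" "\<And>k. k < n \<Longrightarrow> int n dvd a * int k - c \<longleftrightarrow> k = t"
proof -
  obtain b where b: "[a * b = 1] (mod int n)" using cong_solve_coprime_int[OF assms(1)] by blast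
  define t where "t = nat ((b * c) mod int n)"
  have t: "int t = (b * c) mod int n" using assms(2) by (simp add: t_def)
  have "[a * int t = a * b * c] (mod int n)" unfolding t by (simp add: cong_def mod_simps mult.assoc)
  also have "[a * b * c = 1 * c] (mod int n)" by (rule cong_mult[OF b cong_refl])
  finally have at: "[a * int t = c] (mod int n)" by simp
  have "t < n" using t assms(2) by (metis of_nat_0_less_iff of_nat_less_iff pos_mod_bound)
  moreover have "int n dvd a * int k - c \<longleftrightarrow> k = t" if "k < n" for k
  proof -
    have "int n dvd a * int k - c \<longleftrightarrow> [a * int k = c] (mod int n)" by (simp add: cong_iff_dvd_diff)
    also have "\<dots> \<longleftrightarrow> [a * int k = a * int t] (mod int n)"
      using at by (meson cong_sym cong_trans)
    also have "\<dots> \<longleftrightarrow> [int k = int t] (mod int n)"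
      by (rule cong_mult_lcancel) (rule assms(1))
    also have "\<dots> \<longleftrightarrow> k = t" using that \<open>t < n\<close> by (simp add: cong_int_iff cong_def)
    finally show ?thesis .
  qed
  ultimately show ?thesis by (rule that)
qed

lemma shift_vec_norm:
  assumes "p > 0"
  shows "shift_vec p m c \<bullet>c shift_vec p m c = 1"
  using assms by (simp add: shift_inner_shift shift_phase_def)

lemma block_vec_norm:
  assumes "t < p"
  shows "block_vec p t \<alpha> \<beta> \<bullet>c block_vec p t \<alpha> \<beta> = 1"
  using assms by (simp add: block_inner_block quad_phase_def)

text \<open>Let M and D be the differences of the parameters. If p does not divide M, exactly one
  block survives and the overlap is 1/p^2. If p divides M but not D, none does. If p divides both,
  all survive with phases of level p: a Gauss sum and overlap 1/p unless p^2 divides M; in that case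
  M = 0 and a vanishing geometric sum remains.\<close>

lemma overlap_shift_shift:
  assumes p: "prime p" and lt: "m < p\<^sup>2" "m' < p\<^sup>2" "c < p\<^sup>2" "c' < p\<^sup>2" and ne: "(m, c) \<noteq> (m', c')"
  shows "overlap (shift_vec p (int m) (int c)) (shift_vec p (int m') (int c')) \<in> {0, 1 / p, 1 / p\<^sup>2}"
proof -
  have p0: "p > 0" using p by (rule prime_gt_0_nat)
  define M where "M = int m - int m'"
  define D where "D = int c - int c'"
  \<comment> \<open>Both differences are smaller than p^2 in absolute value, so divisibility by p^2
    makes them zero.\<close>
  have small: "x = 0" if "\<bar>x\<bar> < int (p\<^sup>2)" "int p * int p dvd x" for x
    using that by (metis dvd_imp_le_int linorder_not_le of_nat_power power2_eq_square abs_of_nat)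
  have bnd: "\<bar>M\<bar> < int (p\<^sup>2)" "\<bar>D\<bar> < int (p\<^sup>2)"
    unfolding M_def D_def using lt by linarith+
  define S where "S = (\<Sum>t<p. if int p dvd M * int t - D then shift_phase p M D t else 0)"
  have ov: "overlap (shift_vec p (int m) (int c)) (shift_vec p (int m') (int c')) = (cmod S)\<^sup>2 / p\<^sup>2"
    unfolding overlap_def shift_inner_shift[OF p0] S_def M_def D_def
    by (simp add: norm_divide power_divide)
  show ?thesis
  proof (cases "int p dvd M")
    case False
    then obtain t where t: "t < p" "\<And>k. k < p \<Longrightarrow> int p dvd M * int k - D \<longleftrightarrow> k = t"
      using coprime_cong_solve[OF prime_coprime_int[OF p] p0] by metis
    have "S = (\<Sum>k<p. if k = t then shift_phase p M D t else 0)"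
      unfolding S_def by (intro sum.cong refl) (simp add: t(2))
    then have "cmod S = 1" using t(1) by simp
    then show ?thesis by (simp add: ov)
  next
    case True
    then obtain \<mu> where M: "M = int p * \<mu>" by (elim dvdE)
    show ?thesis
    proof (cases "int p dvd D")
      case False
      then have "S = 0" unfolding S_def M by (simp add: dvd_diff_right_iff mult.assoc)
      then show ?thesis by (simp add: ov)
    next
      case True
      then obtain \<delta> where D: "D = int p * \<delta>" by (elim dvdE)
      have sp: "shift_phase p M D t = quad_phase p \<mu> (- \<mu> * int p - 2 * \<delta>) (int t)" for t
      proof -
        have "shift_phase p M D t
            = phase (p * p) (int p * (\<mu> * (int t)\<^sup>2 + (- \<mu> * int p - 2 * \<delta>) * int t))"
          unfolding shift_phase_def M D power2_eq_square
          by (intro arg_cong[of _ _ "phase _"]) (simp add: algebra_simps)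
        then show ?thesis by (simp only: phase_reduce[OF p0] quad_phase_def)
      qed
      have S: "S = (\<Sum>t<p. quad_phase p \<mu> (- \<mu> * int p - 2 * \<delta>) (int t))"
        unfolding S_def sp by (intro sum.cong refl) (simp add: M D mult.assoc)
      show ?thesis
      proof (cases "int p dvd \<mu>")
        case False
        have "(cmod S)\<^sup>2 = real p"
          unfolding S by (rule norm_gauss_sum[OF p0 prime_coprime_int[OF p False]]) simp
        then show ?thesis by (simp add: ov power2_eq_square)
      next
        case True
        then have "int p * int p dvd M" unfolding M by (rule mult_dvd_mono[OF dvd_refl])
        then have "M = 0" by (rule small[OF bnd(1)])
        then have "\<mu> = 0" using M p0 by simp
        have "D \<noteq> 0" using \<open>M = 0\<close> ne by (simp add: M_def D_def)
        have "\<not> int p dvd \<delta>"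
        proof
          assume "int p dvd \<delta>"
          then have "int p * int p dvd D" unfolding D by (rule mult_dvd_mono[OF dvd_refl])
          then show False using small[OF bnd(2)] \<open>D \<noteq> 0\<close> by blast
        qed
        then have "S = 0"
          using sum_phase[OF p0, of "- \<delta>"] by (simp add: S \<open>\<mu> = 0\<close> quad_phase_def mult.assoc)
        then show ?thesis by (simp add: ov)
      qed
    qed
  qed
qed

lemma overlap_shift_block:
  assumes t: "t < p" and "coprime \<alpha> (int p)" "even (\<alpha> * int p + \<beta>)"
  shows "overlap (shift_vec p m c) (block_vec p t \<alpha> \<beta>) = 1 / p\<^sup>2"
proof -
  have "(cmod (\<Sum>v<p. quad_phase p (- \<alpha>) (2 * (m * int t - c) - \<beta>) (int v)))\<^sup>2 = real p"
    by (rule norm_gauss_sum) (use assms in auto)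
  then show ?thesis
    unfolding overlap_def shift_inner_block[OF t]
    by (simp add: norm_mult norm_divide power_divide power_mult_distrib)
qed

lemma overlap_block_block:
  assumes t: "t < p" and "coprime (\<alpha> - \<alpha>') (int p)"
    and ev: "even (\<alpha> * int p + \<beta>)" "even (\<alpha>' * int p + \<beta>')"
  shows "overlap (block_vec p t \<alpha> \<beta>) (block_vec p t \<alpha>' \<beta>') = 1 / p"
proof -
  have "(\<alpha> - \<alpha>') * int p + (\<beta> - \<beta>') = (\<alpha> * int p + \<beta>) - (\<alpha>' * int p + \<beta>')"
    by (simp add: algebra_simps)
  then have "even ((\<alpha> - \<alpha>') * int p + (\<beta> - \<beta>'))" using ev by (simp only: even_diff dvd_add)
  then have "(cmod (\<Sum>v<p. quad_phase p (\<alpha> - \<alpha>') (\<beta> - \<beta>') (int v)))\<^sup>2 = real p"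
    by (intro norm_gauss_sum) (use assms in auto)
  then show ?thesis
    unfolding overlap_def block_inner_block[OF t t]
    by (simp add: norm_divide power_divide power2_eq_square)
qed

text \<open>The leading coefficients are only congruent, since they are chosen separately for each
  label. Their difference p\<mu> still gives a linear phase, because v(v - 1) is even. The sum is
  then geometric, and the two phases differing at one point \<open>x\<close> excludes the trivial
  character.\<close>

lemma overlap_block_block_orthogonal:
  assumes t: "t < p" and cong: "[\<alpha> = \<alpha>'] (mod int p)"
    and ev: "even (\<alpha> * int p + \<beta>)" "even (\<alpha>' * int p + \<beta>')"
    and ne: "quad_phase p \<alpha> \<beta> x \<noteq> quad_phase p \<alpha>' \<beta>' x"
  shows "overlap (block_vec p t \<alpha> \<beta>) (block_vec p t \<alpha>' \<beta>') = 0"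
proof -
  have p: "p > 0" using t by simp
  obtain \<mu> where \<mu>: "\<alpha> - \<alpha>' = int p * \<mu>" using cong by (auto simp: cong_iff_dvd_diff)
  have "(\<alpha> - \<alpha>') * int p + (\<beta> - \<beta>') = (\<alpha> * int p + \<beta>) - (\<alpha>' * int p + \<beta>')"
    by (simp add: algebra_simps)
  then have "even ((\<alpha> - \<alpha>') * int p + (\<beta> - \<beta>'))" using ev by (simp only: even_diff dvd_add)
  then have "even (int p * \<mu> + (\<beta> - \<beta>'))" unfolding \<mu> by auto
  then obtain n where n: "int p * \<mu> + (\<beta> - \<beta>') = 2 * n" by (elim evenE)
  have q: "quad_phase p (\<alpha> - \<alpha>') (\<beta> - \<beta>') v = phase p (2 * (n * v))" for v
    unfolding quad_phase_def \<mu>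
  proof (rule phase_cong[OF p])
    show "even (\<mu> * (v * (v - 1)))" by simp
    have "2 * (n * v) = (int p * \<mu> + (\<beta> - \<beta>')) * v" unfolding n by simp
    then show "int p * \<mu> * v\<^sup>2 + (\<beta> - \<beta>') * v = 2 * (n * v) + int p * (\<mu> * (v * (v - 1)))"
      by (simp only:) (simp add: power2_eq_square algebra_simps)
  qed
  have "\<not> int p dvd n"
  proof
    assume "int p dvd n"
    then have "phase p (2 * (n * x)) = 1" by (simp only: phase_even_eq_1_iff[OF p] dvd_mult2)
    then have "quad_phase p (\<alpha> - \<alpha>') (\<beta> - \<beta>') x = 1" by (simp only: q)
    moreover have "quad_phase p \<alpha> \<beta> x = quad_phase p \<alpha>' \<beta>' x * quad_phase p (\<alpha> - \<alpha>') (\<beta> - \<beta>') x"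
      unfolding quad_phase_def phase_add[symmetric]
      by (intro arg_cong[of _ _ "phase p"]) (simp add: algebra_simps)
    ultimately show False using ne by simp
  qed
  then have "(\<Sum>v<p. quad_phase p (\<alpha> - \<alpha>') (\<beta> - \<beta>') (int v)) = 0"
    unfolding q sum_phase[OF p] by simp
  then show ?thesis unfolding overlap_def block_inner_block[OF t t] by simp
qed

lemma overlap_unit:
  assumes "j < d" "v \<in> carrier_vec d"
  shows "overlap (unit_vec d j) v = (cmod (v $ j))\<^sup>2"
  using assms by (simp add: overlap_def scalar_prod_left_unit)

lemma overlap_unit_shift:
  assumes "j < p\<^sup>2"
  shows "overlap (unit_vec (p\<^sup>2) j) (shift_vec p m c) = 1 / p\<^sup>2"
  using assms by (simp add: overlap_unit) (simp add: shift_vec_def norm_divide power_divide)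

lemma overlap_unit_block:
  assumes "j < p\<^sup>2"
  shows "overlap (unit_vec (p\<^sup>2) j) (block_vec p t \<alpha> \<beta>) \<in> {0, 1 / p}"
  using assms by (simp add: overlap_unit) (simp add: block_vec_def norm_divide power_divide)

section \<open>The labelled eigenvalues on the spans E_t\<close>

lemma eigenvalue_labelling_inj:
  assumes p: "prime p" and g: "eigenvalue_labelling p g" and t: "t < p"
  shows "inj_on (g t) {..<p}"
proof (cases "odd p")
  case True
  have p0: "p > 0" using p by (rule prime_gt_0_nat)
  show ?thesis
  proof (rule inj_onI)
    fix s s' assume s: "s \<in> {..<p}" "s' \<in> {..<p}" "g t s = g t s'"
    have ph: "exp (2 * of_real pi * \<i> * of_nat s / of_nat p) = phase p (2 * int s)" for s
      unfolding phase_def cis_conv_exp by (intro arg_cong[of _ _ exp]) simp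
    have "phase p (2 * int s) = phase p (2 * int s')"
      using s g True t by (simp add: eigenvalue_labelling_def ph)
    then have "phase p (2 * int s) * cnj (phase p (2 * int s')) = phase p 0"
      by (simp only: phase_mult_cnj) simp
    then have "phase p (2 * (int s - int s')) = 1"
      unfolding phase_mult_cnj by (simp add: right_diff_distrib)
    then have "[int s = int s'] (mod int p)"
      by (simp only: phase_even_eq_1_iff[OF p0] cong_iff_dvd_diff)
    then show "s = s'" using s by (simp add: cong_int_iff cong_def)
  qed
next
  case False
  then show ?thesis using g t by (auto simp: eigenvalue_labelling_def bij_betw_def)
qed

text \<open>For odd \<open>p\<close> an even inverse \<open>\<alpha>\<close> of \<open>b\<close> is chosen, so that \<open>\<alpha> v\<^sup>2 + \<beta> v\<close> is even and the
  halves in the phases can be cancelled modulo \<open>p\<close>. For \<open>p = 2\<close> the eigenvalue equation on a block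
  forces \<open>\<kappa>\<^sup>2 = -1\<close>.\<close>

lemma eigenvalue_coefficients:
  assumes p: "prime p" and g: "eigenvalue_labelling p g"
    and b: "0 < b" "b < p" and t: "t < p" and s: "s < p"
  shows "\<exists>\<alpha> \<beta>. [\<alpha> * int b = 1] (mod int p) \<and> even (\<alpha> * int p + \<beta>) \<and>
    g t s = phase (p\<^sup>2) (2 * int t) * phase p (- (\<alpha> * (int b)\<^sup>2 + \<beta> * int b))"
proof (cases "odd p")
  case True
  have p0: "p > 0" using t by simp
  have "\<not> int p dvd int b" using b by (auto dest: zdvd_imp_le)
  then obtain c where c: "[int b * c = 1] (mod int p)"
    using cong_solve_coprime_int[OF prime_coprime_int[OF p]] by blast
  define \<alpha> where "\<alpha> = (if even c then c else c + int p)"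
  have "[\<alpha> * int b = c * int b] (mod int p)" by (simp add: \<alpha>_def cong_def algebra_simps)
  then have 1: "[\<alpha> * int b = 1] (mod int p)" using c by (metis cong_trans mult.commute)
  have "even \<alpha>" using True by (simp add: \<alpha>_def)
  then obtain a where a: "\<alpha> = 2 * a" by (elim evenE)
  \<comment> \<open>Chosen so that -2(ab^2 + e) = 2s. With \<beta> = 2ce, where \<open>c\<close>
    inverts \<open>b\<close>, the product of \<beta> and \<open>b\<close> is 2e up to an even
    multiple of \<open>p\<close>.\<close>
  define e where "e = - int s - a * (int b)\<^sup>2"
  obtain k where k: "int b * c = 1 + int p * k" using c by (metis cong_iff_lin cong_sym)
  have "- (\<alpha> * (int b)\<^sup>2 + 2 * (c * e) * int b) = - (2 * (a * (int b)\<^sup>2) + 2 * (int b * c) * e)"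
    by (simp add: a)
  also have "\<dots> = 2 * int s + int p * (2 * (- k * e))"
    unfolding k by (simp add: e_def algebra_simps)
  finally have "phase p (- (\<alpha> * (int b)\<^sup>2 + 2 * (c * e) * int b)) = phase p (2 * int s)"
    by (intro phase_cong[OF p0, of "2 * (- k * e)"]) simp_all
  moreover have "exp (2 * of_real pi * \<i> * of_nat t / of_nat (p\<^sup>2)) = phase (p\<^sup>2) (2 * int t)"
    unfolding phase_def cis_conv_exp by (intro arg_cong[of _ _ exp]) simp
  moreover have "exp (2 * of_real pi * \<i> * of_nat s / of_nat p) = phase p (2 * int s)"
    unfolding phase_def cis_conv_exp by (intro arg_cong[of _ _ exp]) simp
  ultimately have "g t s = phase (p\<^sup>2) (2 * int t) * phase p (- (\<alpha> * (int b)\<^sup>2 + 2 * (c * e) * int b))"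
    using g True t s by (simp add: eigenvalue_labelling_def)
  moreover have "even (\<alpha> * int p + 2 * (c * e))" using \<open>even \<alpha>\<close> by simp
  ultimately show ?thesis using 1 by blast
next
  case False
  then have p2: "p = 2" using p by (metis prime_odd_nat not_less_iff_gr_or_eq prime_ge_2_nat le_neq_implies_less)
  then have b1: "b = 1" using b by simp
  define \<kappa> where "\<kappa> = g t s / phase (p\<^sup>2) (2 * int t)"
  have gk: "g t s = phase (p\<^sup>2) (2 * int t) * \<kappa>" by (simp add: \<kappa>_def)
  have "g t s \<in> g t ` {..<p}" using s by simp
  also have "g t ` {..<p} = {l. \<exists>v\<in>E_space p t. eigenvector (weyl (p\<^sup>2) 1 p) v l}"
    using g t False by (auto simp: eigenvalue_labelling_def bij_betw_def)
  finally obtain v where v: "v \<in> E_space p t" "eigenvector (weyl (p\<^sup>2) 1 p) v (g t s)" by blast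
  have car: "v \<in> carrier_vec (p\<^sup>2)" and zero: "\<And>k. k < p\<^sup>2 \<Longrightarrow> k mod p \<noteq> t \<Longrightarrow> v $ k = 0"
    using v(1) by (auto simp: E_space_iff[OF t])
  have "weyl (p\<^sup>2) 1 (1 * p) *\<^sub>v v = (phase (p\<^sup>2) (2 * int t) * \<kappa>) \<cdot>\<^sub>v v"
    using v(2) by (simp add: eigenvector_def gk)
  then have eq: "\<forall>x<p. phase p (2 * int x) * v $ (x * p + t) = \<kappa> * v $ ((x + 1) mod p * p + t)"
    by (simp only: weyl_block_eigen_iff[OF t v(1)])
  have m1: "phase 2 2 = - 1" by (simp add: phase_def)
  have e0: "v $ t = \<kappa> * v $ (2 + t)" using eq[rule_format, of 0] p2 by simp
  have e1: "- v $ (2 + t) = \<kappa> * v $ t" using eq[rule_format, of 1] p2 m1 by simp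
  \<comment> \<open>Otherwise \<open>e0\<close> makes the other entry of the block vanish too, and
    an eigenvector is not zero.\<close>
  have "v $ (2 + t) \<noteq> 0"
  proof
    assume "v $ (2 + t) = 0"
    then have "v $ k = 0" if "k < p\<^sup>2" for k
    proof (cases "k mod p = t")
      case True
      obtain x where x: "k = x * p + k mod p" "x < p" by (rule block_indexE[OF \<open>k < p\<^sup>2\<close>])
      then have "x = 0 \<or> x = 1" using p2 by auto
      then have "k = t \<or> k = 2 + t" using x True p2 by auto
      then show ?thesis using e0 \<open>v $ (2 + t) = 0\<close> by auto
    qed (use zero that in auto)
    then have "v = 0\<^sub>v (p\<^sup>2)" using car by (intro eq_vecI) auto
    then show False using v(2) by (simp add: eigenvector_def weyl_def)
  qed
  moreover have "- v $ (2 + t) = \<kappa>\<^sup>2 * v $ (2 + t)" using e0 e1 by (simp add: power2_eq_square)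
  ultimately have "\<kappa>\<^sup>2 = - 1" by (metis mult_cancel_right mult_minus_left mult_1)
  then have "(\<kappa> - \<i>) * (\<kappa> + \<i>) = 0" by (simp add: algebra_simps power2_eq_square)
  then have \<kappa>: "\<kappa> = \<i> \<or> \<kappa> = - \<i>" by (auto simp: eq_neg_iff_add_eq_0)
  have mi: "phase 2 (- 1) = - \<i>" by (simp add: phase_def)
  have "phase 2 (- 3) = phase 2 (- 1) * phase 2 (- 2)" by (simp flip: phase_add)
  also have "phase 2 (- 2) = - 1" using m1 cnj_phase[of 2 2] by simp
  finally have pi: "phase 2 (- 3) = \<i>" by (simp add: mi)
  \<comment> \<open>With \<alpha> = 1 the parity condition asks for even \<beta>; the values 0 and 2
    give the two square roots of -1.\<close>
  have "\<exists>\<beta>. even \<beta> \<and> \<kappa> = phase 2 (- (1 + \<beta>))"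
    using \<kappa>
  proof
    assume "\<kappa> = \<i>"
    then show ?thesis by (intro exI[of _ 2]) (simp add: pi)
  next
    assume "\<kappa> = - \<i>"
    then show ?thesis by (intro exI[of _ 0]) (simp add: mi)
  qed
  then obtain \<beta> where "even \<beta>" "\<kappa> = phase 2 (- (1 + \<beta>))" by blast
  then show ?thesis unfolding gk by (intro exI[of _ 1] exI[of _ \<beta>]) (simp add: p2 b1)
qed

section \<open>Counting the projections\<close>

text \<open>All three claims follow from pairwise overlaps. As p > 1, none of the three values is 1,
  whereas equal projections would have overlap 1; so distinct indices give distinct
  projections.\<close>

lemma ketbra_family:
  fixes u :: "'a \<Rightarrow> complex vec" and p :: nat
  assumes p: "p > 1"
    and car: "\<And>l. l \<in> L \<Longrightarrow> u l \<in> carrier_vec d"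
    and norm: "\<And>l. l \<in> L \<Longrightarrow> u l \<bullet>c u l = 1"
    and ov: "\<And>l l'. l \<in> L \<Longrightarrow> l' \<in> L \<Longrightarrow> l \<noteq> l' \<Longrightarrow> overlap (u l) (u l') \<in> {0, 1 / p, 1 / p\<^sup>2}"
  defines "K \<equiv> \<lambda>l. ketbra (u l) (u l)"
  shows "\<forall>P\<in>K ` L. rank_one_projection d P"
    and "card (K ` L) = card L"
    and "\<forall>P\<in>K ` L. \<forall>P'\<in>K ` L. mat_trace (P * P') \<in> {0, 1 / of_nat p, 1 / of_nat p ^ 2, 1}"
proof -
  have tr: "mat_trace (K l * K l') = of_real (overlap (u l) (u l'))" if "l \<in> L" "l' \<in> L" for l l'
    unfolding K_def overlap_def using that by (intro trace_ketbra_mult_ketbra[OF car car])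
  have self: "overlap (u l) (u l) = 1" if "l \<in> L" for l
    using norm[OF that] by (simp add: overlap_def)
  show "\<forall>P\<in>K ` L. rank_one_projection d P"
    using rank_one_projection_ketbra[OF car norm] by (auto simp: K_def)
  have "inj_on K L"
  proof (rule inj_onI, rule ccontr)
    fix l l' assume l: "l \<in> L" "l' \<in> L" "K l = K l'" "l \<noteq> l'"
    then have "of_real (overlap (u l) (u l')) = (of_real (overlap (u l) (u l)) :: complex)"
      using tr[of l l] tr[of l l'] by simp
    then have "overlap (u l) (u l') = 1" using self l by simp
    have "1 < (real p)\<^sup>2" using p by (intro one_less_power) auto
    then have "(real p)\<^sup>2 \<noteq> 1" by linarith
    with \<open>overlap (u l) (u l') = 1\<close> show False using ov[of l l'] l p by auto
  qed
  then show "card (K ` L) = card L" by (rule card_image)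
  have "overlap (u l) (u l') \<in> {0, 1 / p, 1 / p\<^sup>2, 1}" if "l \<in> L" "l' \<in> L" for l l'
    using ov[OF that] self that by (cases "l = l'") auto
  then have "mat_trace (K l * K l') \<in> of_real ` {0, 1 / p, 1 / p\<^sup>2, 1}" if "l \<in> L" "l' \<in> L" for l l'
    using that tr by (metis image_eqI)
  then show "\<forall>P\<in>K ` L. \<forall>P'\<in>K ` L. mat_trace (P * P') \<in> {0, 1 / of_nat p, 1 / of_nat p ^ 2, 1}"
    by auto
qed

text \<open>Counting is done on labels, where disjointness of the families is a matter of
  constructors, and is carried over by injectivity.\<close>

datatype label = Basis nat | Block nat nat nat | Shift nat nat nat nat

definition labels :: "nat \<Rightarrow> label set" where
  "labels p = {Basis j | j. j < p\<^sup>2} \<union>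
    {Block b t s | b t s. 0 < b \<and> b < p \<and> t < p \<and> 0 < s \<and> s < p} \<union>
    {Shift r a c s | r a c s. r < p \<and> a < p \<and> c < p \<and> s < p \<and>
      (if a = 0 then (c, s) \<noteq> (0, 0) else 0 < s)}"

text \<open>The families have p^2, p(p - 1)^2, p(p^2 - 1) and p^2(p - 1)^2 members, the last two
  being those with a = 0 and with a > 0.\<close>

lemma card_labels:
  assumes "p > 0"
  shows "card (labels p) = p ^ 4"
proof -
  let ?B = "Basis ` {..<p\<^sup>2}"
  let ?Q = "(\<lambda>(b, t, s). Block b t s) ` ({1..<p} \<times> {..<p} \<times> {1..<p})"
  let ?P0 = "(\<lambda>(r, c, s). Shift r 0 c s) ` ({..<p} \<times> ({..<p} \<times> {..<p} - {(0, 0)}))"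
  let ?P1 = "(\<lambda>(r, a, c, s). Shift r a c s) ` ({..<p} \<times> {1..<p} \<times> {..<p} \<times> {1..<p})"
  have L: "labels p = ?B \<union> (?Q \<union> (?P0 \<union> ?P1))"
    unfolding labels_def Un_assoc
  proof (intro arg_cong2[of _ _ _ _ "(\<union>)"])
    show "{Basis j | j. j < p\<^sup>2} = ?B" by auto
    show "{Block b t s | b t s. 0 < b \<and> b < p \<and> t < p \<and> 0 < s \<and> s < p} = ?Q"
      by (auto simp: image_def Bex_def)
    show "{Shift r a c s | r a c s. r < p \<and> a < p \<and> c < p \<and> s < p \<and>
        (if a = 0 then (c, s) \<noteq> (0, 0) else 0 < s)} = ?P0 \<union> ?P1"
      (is "?L = ?R")
    proof (rule Set.set_eqI)
      show "l \<in> ?L \<longleftrightarrow> l \<in> ?R" for l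
        using assms by (cases l) (auto simp: image_def Bex_def)
    qed
  qed
  have "card (labels p) = card ?B + (card ?Q + (card ?P0 + card ?P1))"
  proof -
    have "?B \<inter> (?Q \<union> (?P0 \<union> ?P1)) = {}" "?Q \<inter> (?P0 \<union> ?P1) = {}" "?P0 \<inter> ?P1 = {}"
      by auto
    then show ?thesis unfolding L by (simp only: card_Un_disjoint finite_imageI finite_UnI finite_cartesian_product
          finite_lessThan finite_atLeastLessThan finite_Diff)
  qed
  moreover have "card ?B = p\<^sup>2" by (simp add: card_image inj_on_def)
  moreover have "card ?Q = (p - 1) * (p * (p - 1))"
    by (subst card_image) (auto simp: inj_on_def card_cartesian_product)
  moreover have "card ?P0 = p * (p * p - 1)"
    using assms by (subst card_image) (auto simp: inj_on_def card_cartesian_product)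
  moreover have "card ?P1 = p * ((p - 1) * (p * (p - 1)))"
    by (subst card_image) (auto simp: inj_on_def card_cartesian_product)
  \<comment> \<open>Removes the truncated subtractions.\<close>
  moreover obtain n where "p = Suc n" using assms by (cases p) auto
  ultimately show ?thesis by (simp add: power2_eq_square power4_eq_xxxx algebra_simps)
qed

text \<open>The assumption on \<open>Block\<close> is confined to labels in range, because suitable
  coefficients \<alpha> and \<beta> are available only there.\<close>

lemma P_prime_eq_image:
  assumes p: "p > 0"
    and basis: "\<And>j. K (Basis j) = ketbra (unit_vec (p\<^sup>2) j) (unit_vec (p\<^sup>2) j)"
    and block: "\<And>b t s. 0 < b \<Longrightarrow> b < p \<Longrightarrow> t < p \<Longrightarrow> s < p \<Longrightarrow> K (Block b t s) = proj_Q p g b t s"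
    and shift: "\<And>r a c s. K (Shift r a c s) = proj_P p r a c s"
  shows "P_prime p g = K ` labels p"
proof -
  have "standard_projs p = K ` {Basis j | j. j < p\<^sup>2}"
    unfolding standard_projs_def basis[symmetric] by blast
  moreover have "Q_projs p g b = {K (Block b t s) | t s. t < p \<and> 0 < s \<and> s < p}" if "0 < b" "b < p" for b
    unfolding Q_projs_def using block[OF that]
    by (intro Collect_cong ex_cong1) (auto simp: Suc_le_eq)
  then have "(\<Union>b\<in>{1..<p}. Q_projs p g b)
      = (\<Union>b\<in>{1..<p}. {K (Block b t s) | t s. t < p \<and> 0 < s \<and> s < p})"
    by (intro SUP_cong) auto
  then have "(\<Union>b\<in>{1..<p}. Q_projs p g b)
      = K ` {Block b t s | b t s. 0 < b \<and> b < p \<and> t < p \<and> 0 < s \<and> s < p}"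
    by (auto simp: image_def Suc_le_eq Bex_def)
  moreover have "(\<Union>r\<in>{..<p}. \<Union>a\<in>{..<p}. P_projs p r a)
      = K ` {Shift r a c s | r a c s. r < p \<and> a < p \<and> c < p \<and> s < p \<and>
          (if a = 0 then (c, s) \<noteq> (0, 0) else 0 < s)}"
  proof -
    define ok where "ok a c s \<longleftrightarrow> (if a = 0 then (c, s) \<noteq> (0, 0) else 0 < s)" for a c s :: nat
    have "P_projs p r a = {K (Shift r a c s) | c s. c < p \<and> s < p \<and> ok a c s}" for r a
      unfolding P_projs_def shift ok_def by (auto simp: Suc_le_eq)
    then have "(\<Union>r\<in>{..<p}. \<Union>a\<in>{..<p}. P_projs p r a)
        = K ` {Shift r a c s | r a c s. r < p \<and> a < p \<and> c < p \<and> s < p \<and> ok a c s}"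
      by (auto simp: image_def Bex_def) blast
    then show ?thesis by (simp only: ok_def)
  qed
  ultimately show ?thesis by (simp only: P_prime_def labels_def image_Un)
qed

lemma proj_P_eq_ketbra:
  assumes p: "p > 0"
  shows "proj_P p r a c s = ketbra (shift_vec p (int (a * p + r)) (int (c + p * s)))
    (shift_vec p (int (a * p + r)) (int (c + p * s)))"
  unfolding proj_P_def gam_eq_phase[OF p] eigenspace_shift[OF p]
  by (intro proj_onto_line shift_vec_norm shift_vec_carrier p)

text \<open>Uniqueness of base p digits; it turns distinct labels (r, a, c, s) into distinct
  parameters of \<open>shift_vec\<close>.\<close>

lemma block_index_eq_iff:
  fixes p :: nat
  assumes "t < p" "t' < p"
  shows "v * p + t = v' * p + t' \<longleftrightarrow> v = v' \<and> t = t'"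
proof
  assume eq: "v * p + t = v' * p + t'"
  then have "(v * p + t) mod p = (v' * p + t') mod p" by simp
  then have "t = t'" using assms by simp
  then show "v = v' \<and> t = t'" using eq assms by simp
qed simp

theorem theorem3p6p5:
  fixes p :: nat and g :: "nat \<Rightarrow> nat \<Rightarrow> complex"
  assumes "prime p" and "eigenvalue_labelling p g"
  shows "(\<forall>P\<in>P_prime p g. rank_one_projection (p^2) P) \<and>
         card (P_prime p g) = p^4 \<and>
         (\<forall>P\<in>P_prime p g. \<forall>P'\<in>P_prime p g.
            mat_trace (P * P') \<in> {0, 1 / of_nat p, 1 / of_nat p ^ 2, 1})"
proof -
  note p = assms(1) and g = assms(2)
  have p1: "p > 1" using p by (rule prime_gt_1_nat)
  then have p0: "p > 0" by simp
  \<comment> \<open>The range conditions stand inside the existential, so that total choice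
    functions exist, unconstrained outside the range.\<close>
  have "\<forall>b t s. \<exists>\<alpha> \<beta>. 0 < b \<and> b < p \<and> t < p \<and> s < p \<longrightarrow>
      [\<alpha> * int b = 1] (mod int p) \<and> even (\<alpha> * int p + \<beta>) \<and>
      g t s = phase (p\<^sup>2) (2 * int t) * phase p (- (\<alpha> * (int b)\<^sup>2 + \<beta> * int b))"
    using eigenvalue_coefficients[OF p g] by blast
  then obtain \<alpha> \<beta> where \<alpha>\<beta>: "\<And>b t s. 0 < b \<and> b < p \<and> t < p \<and> s < p \<longrightarrow>
      [\<alpha> b t s * int b = 1] (mod int p) \<and> even (\<alpha> b t s * int p + \<beta> b t s) \<and>
      g t s = phase (p\<^sup>2) (2 * int t) * phase p (- (\<alpha> b t s * (int b)\<^sup>2 + \<beta> b t s * int b))"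
    by metis
  have inv: "[\<alpha> b t s * int b = 1] (mod int p)" and ev: "even (\<alpha> b t s * int p + \<beta> b t s)"
    and g_eq: "g t s = phase (p\<^sup>2) (2 * int t) * cnj (quad_phase p (\<alpha> b t s) (\<beta> b t s) (int b))"
    if "0 < b" "b < p" "t < p" "s < p" for b t s
    using \<alpha>\<beta>[of b t s] that unfolding quad_phase_def cnj_phase by blast+
  define u where "u l = (case l of
      Basis j \<Rightarrow> unit_vec (p\<^sup>2) j
    | Block b t s \<Rightarrow> block_vec p t (\<alpha> b t s) (\<beta> b t s)
    | Shift r a c s \<Rightarrow> shift_vec p (int (a * p + r)) (int (c + p * s)))" for l
  have car: "u l \<in> carrier_vec (p\<^sup>2)" for l
    by (simp add: u_def split: label.split)
  have norm: "u l \<bullet>c u l = 1" if "l \<in> labels p" for l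
    using that p0 by (auto simp: labels_def u_def block_vec_norm shift_vec_norm)
  have Q: "proj_Q p g b t s = ketbra (u (Block b t s)) (u (Block b t s))"
    if "0 < b" "b < p" "t < p" "s < p" for b t s
  proof -
    have "g t s = phase (p\<^sup>2) (2 * int t) * phase p (- (\<alpha> b t s * (int b)\<^sup>2 + \<beta> b t s * int b))"
      using \<alpha>\<beta>[of b t s] that by blast
    then show ?thesis
      using inv[OF that] ev[OF that] that(3)
      by (simp only: proj_Q_def block_eigen_line u_def label.case
          proj_onto_line[OF block_vec_carrier block_vec_norm])
  qed
  have image: "P_prime p g = (\<lambda>l. ketbra (u l) (u l)) ` labels p"
    by (rule P_prime_eq_image[OF p0]) (simp_all add: Q proj_P_eq_ketbra[OF p0], simp_all add: u_def)
  have coprime_inv: "coprime a (int p)" if "[a * x = 1] (mod int p)" for a x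
    using that by (metis coprime_iff_invertible_int)
  have block_block: "overlap (u (Block b t s)) (u (Block b' t' s')) \<in> {0, 1 / p}"
    if lt: "0 < b" "b < p" "t < p" "s < p" "0 < b'" "b' < p" "t' < p" "s' < p"
      and ne: "(b, t, s) \<noteq> (b', t', s')" for b t s b' t' s'
  proof (cases "t = t'")
    case False
    then show ?thesis using lt by (simp add: u_def overlap_def block_inner_block)
  next
    case True
    let ?a = "\<alpha> b t s" and ?a' = "\<alpha> b' t s'"
    have i: "[?a * int b = 1] (mod int p)" "[?a' * int b' = 1] (mod int p)"
      using inv lt True by auto
    show ?thesis
    proof (cases "[?a = ?a'] (mod int p)")
      case False
      then have "coprime (?a - ?a') (int p)"
        by (intro prime_coprime_int p) (simp add: cong_iff_dvd_diff)
      then show ?thesis using overlap_block_block ev lt True by (simp add: u_def)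
    next
      case cong: True
      \<comment> \<open>Congruent coefficients have congruent inverses, so \<open>b = b'\<close> and
        the labels differ in \<open>s\<close> alone. The eigenvalues then differ, and by
        \<open>g_eq\<close> so do the quadratic phases at \<open>b\<close>.\<close>
      have "[?a * int b = ?a * int b'] (mod int p)"
        using i cong_mult[OF cong cong_refl[of "int b'"]] by (meson cong_sym cong_trans)
      then have "[int b = int b'] (mod int p)"
        using cong_mult_lcancel[OF coprime_inv[OF i(1)]] by blast
      then have b: "b = b'" using lt by (simp add: cong_int_iff cong_def)
      then have "s \<noteq> s'" using ne True by simp
      then have "g t s \<noteq> g t s'"
        using inj_on_eq_iff[OF eigenvalue_labelling_inj[OF p g lt(3)]] lt by simp
      then have "quad_phase p ?a (\<beta> b t s) (int b) \<noteq> quad_phase p ?a' (\<beta> b' t s') (int b)"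
        using g_eq[of b t s] g_eq[of b t s'] lt b by auto
      then show ?thesis
        using overlap_block_block_orthogonal[OF _ cong] ev lt True by (simp add: u_def)
    qed
  qed
  have shift_shift: "overlap (u (Shift r a c s)) (u (Shift r' a' c' s')) \<in> {0, 1 / p, 1 / p\<^sup>2}"
    if lt: "r < p" "a < p" "c < p" "s < p" "r' < p" "a' < p" "c' < p" "s' < p"
      and ne: "(r, a, c, s) \<noteq> (r', a', c', s')" for r a c s r' a' c' s'
  proof -
    have ne': "(a * p + r, s * p + c) \<noteq> (a' * p + r', s' * p + c')"
      using ne lt by (auto simp: block_index_eq_iff)
    have "u (Shift r a c s) = shift_vec p (int (a * p + r)) (int (s * p + c))" for r a c s
      by (simp add: u_def ac_simps)
    moreover have "overlap (shift_vec p (int (a * p + r)) (int (s * p + c)))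
        (shift_vec p (int (a' * p + r')) (int (s' * p + c'))) \<in> {0, 1 / p, 1 / p\<^sup>2}"
      using overlap_shift_shift[OF p _ _ _ _ ne'] lt by (simp add: block_index_less)
    ultimately show ?thesis by (simp only:)
  qed
  \<comment> \<open>Symmetry reduces the nine pairs of constructors to six.\<close>
  have sym: "overlap (u l) (u l') = overlap (u l') (u l)" for l l'
    by (rule overlap_commute[OF car car])
  have unit_unit: "overlap (u (Basis j)) (u (Basis j')) = 0" if "j < p\<^sup>2" "j' < p\<^sup>2" "j \<noteq> j'" for j j'
    using that by (simp add: u_def overlap_unit)
  have unit_block: "overlap (u (Basis j)) (u (Block b t s)) \<in> {0, 1 / p}" if "j < p\<^sup>2" for j b t s
    using overlap_unit_block[OF that] by (simp add: u_def)
  have unit_shift: "overlap (u (Basis j)) (u (Shift r a c s)) = 1 / p\<^sup>2" if "j < p\<^sup>2" for j r a c s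
    using overlap_unit_shift[OF that] by (simp add: u_def)
  have shift_block: "overlap (u (Shift r a c s)) (u (Block b t s')) = 1 / p\<^sup>2"
    if "0 < b" "b < p" "t < p" "s' < p" for r a c s b t s'
    using overlap_shift_block[OF that(3) coprime_inv[OF inv[OF that]] ev[OF that]] by (simp add: u_def)
  have ov: "overlap (u l) (u l') \<in> {0, 1 / p, 1 / p\<^sup>2}"
    if "l \<in> labels p" "l' \<in> labels p" "l \<noteq> l'" for l l'
  proof (cases l)
    case l: (Basis j)
    then have j: "j < p\<^sup>2" using that(1) by (simp add: labels_def)
    show ?thesis
    proof (cases l')
      case (Basis j')
      then show ?thesis using that l unit_unit[OF j, of j'] by (simp add: labels_def)
    next
      case (Block b t s)
      then show ?thesis using l unit_block[OF j, of b t s] by auto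
    next
      case (Shift r a c s)
      then show ?thesis using l unit_shift[OF j, of r a c s] by simp
    qed
  next
    case l: (Block b t s)
    then have lt: "0 < b" "b < p" "t < p" "s < p" using that(1) by (simp_all add: labels_def)
    show ?thesis
    proof (cases l')
      case (Basis j)
      then have "j < p\<^sup>2" using that(2) by (simp add: labels_def)
      then show ?thesis using unit_block[of j b t s] unfolding l Basis sym[of "Block b t s"] by auto
    next
      case (Block b' t' s')
      then show ?thesis
        using that(2,3) block_block[OF lt, of b' t' s'] l by (auto simp: labels_def)
    next
      case (Shift r a c s')
      show ?thesis using shift_block[OF lt, of r a c s'] unfolding l Shift sym[of "Block b t s"] by simp
    qed
  next
    case l: (Shift r a c s)
    then have lt: "r < p" "a < p" "c < p" "s < p" using that(1) by (simp_all add: labels_def)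
    show ?thesis
    proof (cases l')
      case (Basis j)
      then have "j < p\<^sup>2" using that(2) by (simp add: labels_def)
      then show ?thesis
        using unit_shift[of j r a c s] unfolding l Basis sym[of "Shift r a c s"] by simp
    next
      case (Block b t s')
      then have "0 < b" "b < p" "t < p" "s' < p" using that(2) by (simp_all add: labels_def)
      then show ?thesis using shift_block[of b t s' r a c s] l Block by simp
    next
      case (Shift r' a' c' s')
      then have "r' < p" "a' < p" "c' < p" "s' < p" using that(2) by (simp_all add: labels_def)
      then show ?thesis using shift_shift[OF lt, of r' a' c' s'] that(3) l Shift by simp
    qed
  qed
  show ?thesis
    unfolding image card_labels[OF p0, symmetric]
    by (intro conjI ketbra_family[where L = "labels p" and u = u and d = "p\<^sup>2", OF p1 car norm ov])
qed

end
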